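(* Let $(X,Y)$ be one of the pairs of affine types listed in the context, let $L=(L_i^{(a)})_{a\in\bar I^X,\,i\in\mathbb Z_{>0}}$ be nonnegative integers with finitely many nonzero (the multiplicities of the factors $B^{a,i}$ in a tensor product $B$), and let $\lambda\in\bar P^+$ be a classical dominant weight for $X$. Then there is a bijection $\mathrm{RC}(B,\lambda)\to\mathrm{RC}^v(B,\lambda)$, $(\nu,J)\mapsto(\widehat\nu,\widehat J)$, given as follows: for all $a\in\bar I^X$, $b\in\iota(a)\subset\bar I^Y$ and $i\in\mathbb Z_{>0}$, $$\widehat m_{\gamma_ai}^{(b)}=m_i^{(a)},\qquad \widehat J^{(b,\gamma_ai)}=\gamma_aJ^{(a,i)},$$ except when $X=A_{2n}^{(2)}$ and $a=n$, in which case $\widehat m_i^{(n)}=m_i^{(n)}$ and $\widehat J^{(n,i)}=2J^{(n,i)}$ (all entries of $\widehat m$ not specified are $0$, with empty partitions). The cocharge changes by $$\mathrm{cc}(\widehat\nu,\widehat J)=\gamma_0\,\mathrm{cc}(\nu,J).$$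
   Context: **Embeddings.** $I^X,I^Y$ are the sets of Dynkin nodes (0 the affine node), $\bar I=I\setminus\{0\}$; classical fundamental weights $\bar\Lambda_a$, simple roots $\alpha_a$. $\iota$ sends nodes of $X$ to orbits in $I^Y$ of a diagram automorphism $\sigma$ of $Y$ fixing $0$; always $\iota(0)=\{0\}$. The pairs, $\iota$, and factors $\gamma_i$ are: - $Y=A_{2n-1}^{(1)}$, $X=C_n^{(1)}$ ($n\ge2$), $A_{2n}^{(2)}$ ($n\ge1$), $D_{n+1}^{(2)}$ ($n\ge2$): $\iota(i)=\{i,2n-i\}$ ($1\le i<n$), $\iota(n)=\{n\}$; $\gamma_i=1$ for $1\le i\le n-1$, and $(\gamma_0,\gamma_n)=(2,2),(1,2),(1,1)$ respectively. - $Y=D_{n+1}^{(1)}$, $X=B_n^{(1)}$ ($n\ge3$), $A_{2n-1}^{(2)}$ ($n\ge2$): $\iota(i)=\{i\}$ ($i<n$), $\iota(n)=\{n,n+1\}$; for $B_n^{(1)}$, $\gamma_i=2$ ($i<n$), $\gamma_n=1$; for $A_{2n-1}^{(2)}$ all $\gamma_i=1$. (For $n=2$, $D_3^{(1)}$ is the diagram in which nodes $0$ and $1$ are each joined to $2$ and $3$, i.e. that of $A_3^{(1)}$ relabelled.) - $Y=E_6^{(1)}$ (nodes $1$–$2$–$3$–$4$–$5$ a chain, $3$–$6$–$0$), $X=F_4^{(1)},E_6^{(2)}$ (nodes $0,1,2,3,4$ in a chain, double bond between $2$ and $3$): $\iota(1)=\{6\}$, $\iota(2)=\{3\}$, $\iota(3)=\{2,4\}$,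 $\iota(4)=\{1,5\}$; for $F_4^{(1)}$ (arrow from 2 to 3) $\gamma_0=\gamma_1=\gamma_2=2,\gamma_3=\gamma_4=1$; for $E_6^{(2)}$ (arrow from 3 to 2) all $\gamma_i=1$. - $Y=D_4^{(1)}$ (node $2$ central), $X=G_2^{(1)},D_4^{(3)}$ (nodes $0,1,2$ in a chain, triple bond between $1$ and $2$): $\iota(1)=\{2\}$, $\iota(2)=\{1,3,4\}$; for $G_2^{(1)}$ (arrow from 1 to 2) $\gamma_0=\gamma_1=3,\gamma_2=1$; for $D_4^{(3)}$ (arrow from 2 to 1) all $\gamma_i=1$. The remaining nodes are labelled as in Kac's standard tables: in the classical subalgebras $B_n,C_n$ node $n$ is at the end with the double bond; $A_{2n}^{(2)}$ and $A_{2n-1}^{(2)}$ have classical subalgebra $C_n$, $D_{n+1}^{(2)}$ has $B_n$, $E_6^{(2)}$ has $F_4$, $D_4^{(3)}$ has $G_2$. Put $\Psi(\bar\Lambda^X_a)=\gamma_a\sum_{b\in\iota(a)}\bar\Lambda_b^Y$, extended linearly. **Rigged configurations** (for any of the types $X$ or $Y$). Set $\tilde\alpha_a=\alpha_a$ except for type $A_{2n}^{(2)}$, where $\tilde\alpha_a$ are the simple roots of type $B_n$. The invariant form and integers $t_a,t_a^\vee$ ($a\in\bar I$) are: untwisted types: long roots have $(\alpha|\alpha)=2$, $t_a=2/(\alpha_a|\alpha_a)$, $t_a^\vee=1$; types $X_N^{(r)}$, $r>1$, other than $A_{2n}^{(2)}$: long roots have $(\alpha|\alpha)=2r$, $t_a=1$,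 $t_a^\vee=(\alpha_a|\alpha_a)/2$; type $A_{2n}^{(2)}$: $(\tilde\alpha_a|\tilde\alpha_a)=4$ for $a<n$ and $=2$ for $a=n$, $t_a=1$, $t_a^\vee=2$. Given $L=(L_i^{(a)})$ and $\lambda\in\bar P^+$, a $(B,\lambda)$-configuration is a matrix $\nu=(m_i^{(a)})$ of nonnegative integers ($a\in\bar I$, $i\in\mathbb Z_{>0}$, finitely many nonzero) with $$\sum_{a,i}i\,m_i^{(a)}\tilde\alpha_a=\sum_{a,i}i\,L_i^{(a)}\bar\Lambda_a-\lambda,$$ where for type $A_{2n}^{(2)}$ the right side is replaced by its image under the linear map from the $C_n$ weight lattice to the $B_n$ weight lattice with $\bar\Lambda_a^C\mapsto\bar\Lambda_a^B$ ($a<n$), $\bar\Lambda_n^C\mapsto2\bar\Lambda_n^B$. Put $$p_i^{(a)}=\sum_{k\ge1}\Big(L_k^{(a)}\min(i,k)-\frac1{t_a^\vee}\sum_{b\in\bar I}(\tilde\alpha_a|\tilde\alpha_b)\min(t_bi,t_ak)\,m_k^{(b)}\Big).$$ $\nu$ is admissible if $p_i^{(a)}\ge0$ for all $a,i$; $C(B,\lambda)$ is the set of admissible configurations. $\mathrm{RC}(B,\lambda)$ is the set of pairs $(\nu,J)$ with $\nu\in C(B,\lambda)$ and $J=(J^{(a,i)})$ partitions, $J^{(a,i)}$ having at most $m_i^{(a)}$ parts, each at most $p_i^{(a)}$. Cocharge: $$\mathrm{cc}(\nu,J)=\frac12\sum_{a,b\in\bar I}\sum_{j,k\ge1}(\tilde\alpha_a|\tilde\alpha_b)\min(t_bj,t_ak)m_j^{(a)}m_k^{(b)}+\sum_{a,i}t_a^\vee|J^{(a,i)}|.$$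 **Virtual rigged configurations.** Given $L$ for $X$, define $\widehat L$ for $Y$ (the data of the $Y$-crystal $\widehat V$) by $\widehat L_{\gamma_ai}^{(b)}=L_i^{(a)}$ for $b\in\iota(a)$ and $\widehat L_j^{(b)}=0$ for $j\notin\gamma_a\mathbb Z$, except that for $X=A_{2n}^{(2)}$, $a=n$: $\widehat L_i^{(n)}=2L_i^{(n)}$ for all $i$. $\mathrm{RC}^v(B,\lambda)$ is the set of $(\widehat\nu,\widehat J)\in\mathrm{RC}(\widehat V,\Psi(\lambda))$ (type $Y$, data $\widehat L$), $\widehat\nu=(\widehat m_i^{(b)})$, such that (1) for all $i$, $\widehat m_i^{(b)}=\widehat m_i^{(b')}$ and $\widehat J^{(b,i)}=\widehat J^{(b',i)}$ whenever $b,b'$ are in the same $\sigma$-orbit (i.e. the same $\iota(a)$); (2) for all $i$, $a\in\bar I^X$, $b\in\iota(a)$: $\widehat m_j^{(b)}=0$ if $j\notin\gamma_a\mathbb Z$, and all parts of $\widehat J^{(b,i)}$ are multiples of $\gamma_a$. For a partition $J$, $\gamma J$ multiplies every part by $\gamma$.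
   Formalization: In condition (2) for RC^v with X=A_{2n}^{(2)} and a=n, the requirement that m̂_j^{(n)}=0 for j not in γ_nZ is dropped (all indices j allowed), since otherwise the claim fails, e.g. A_2^{(2)}, L_1^{(1)}=1, λ=0; parts of Ĵ^{(n,i)} are still multiples of γ_n=2. *)

theory Defs
  imports Complex_Main "HOL-Library.Multiset"
begin

section \<open>Affine types and their classical data\<close>

datatype affine_type =
    A1 nat       \<comment> \<open>\<open>A1 n\<close> is \<open>A\<^sub>n\<^sup>(\<^sup>1\<^sup>)\<close>; likewise for \<open>B1\<close>, \<open>C1\<close>, \<open>D1\<close>\<close>
  | B1 nat
  | C1 nat
  | D1 nat
  | E6_1
  | F4_1
  | G2_1
  | A2_even nat  \<comment> \<open>\<open>A2_even n\<close> is \<open>A\<^sub>2\<^sub>n\<^sup>(\<^sup>2\<^sup>)\<close>\<close>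
  | A2_odd nat   \<comment> \<open>\<open>A2_odd n\<close> is \<open>A\<^sub>2\<^sub>n\<^sub>-\<^sub>1\<^sup>(\<^sup>2\<^sup>)\<close>\<close>
  | D2 nat       \<comment> \<open>\<open>D2 n\<close> is \<open>D\<^sub>n\<^sub>+\<^sub>1\<^sup>(\<^sup>2\<^sup>)\<close>\<close>
  | E6_2
  | D4_3

fun classical_rank :: "affine_type \<Rightarrow> nat" where
  "classical_rank (A1 n) = n"
| "classical_rank (B1 n) = n"
| "classical_rank (C1 n) = n"
| "classical_rank (D1 n) = n"
| "classical_rank E6_1 = 6"
| "classical_rank F4_1 = 4"
| "classical_rank G2_1 = 2"
| "classical_rank (A2_even n) = n"
| "classical_rank (A2_odd n) = n"
| "classical_rank (D2 n) = n"
| "classical_rank E6_2 = 4"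
| "classical_rank D4_3 = 2"

text \<open>The classical Dynkin nodes, i.e. all nodes except the affine node \<open>0\<close>.\<close>

definition nodes :: "affine_type \<Rightarrow> nat set" where
  "nodes T = {1..classical_rank T}"

text \<open>Edges \<open>a < b\<close> of the classical Dynkin diagram; meaningful only for \<open>a, b \<in> nodes T\<close>.\<close>

fun edge :: "affine_type \<Rightarrow> nat \<Rightarrow> nat \<Rightarrow> bool" where
  "edge (D1 n) a b \<longleftrightarrow> (b = a + 1 \<and> b < n) \<or> (b = a + 2 \<and> b = n)"
| "edge E6_1 a b \<longleftrightarrow> (b = a + 1 \<and> b \<le> 5) \<or> (a = 3 \<and> b = 6)"
| "edge _ a b \<longleftrightarrow> b = a + 1"

text \<open>
  \<open>sq_length T a\<close> is \<open>(\<alpha>\<^sub>a|\<alpha>\<^sub>a)\<close> for the modified simple roots: those of the classical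
  subalgebra, except for \<open>A2_even n\<close>, where the classical subalgebra is \<open>C\<^sub>n\<close> but the simple
  roots of \<open>B\<^sub>n\<close> are used. Long roots have squared length 2 in the untwisted types and \<open>2r\<close> in
  the types of twist \<open>r > 1\<close>.
\<close>

fun sq_length :: "affine_type \<Rightarrow> nat \<Rightarrow> real" where
  "sq_length (A1 n) a = 2"
| "sq_length (B1 n) a = (if a < n then 2 else 1)"
| "sq_length (C1 n) a = (if a < n then 1 else 2)"
| "sq_length (D1 n) a = 2"
| "sq_length E6_1 a = 2"
| "sq_length F4_1 a = (if a \<le> 2 then 2 else 1)"
| "sq_length G2_1 a = (if a = 1 then 2 else 2 / 3)"
| "sq_length (A2_even n) a = (if a < n then 4 else 2)"
| "sq_length (A2_odd n) a = (if a < n then 2 else 4)"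
| "sq_length (D2 n) a = (if a < n then 4 else 2)"
| "sq_length E6_2 a = (if a \<le> 2 then 2 else 4)"
| "sq_length D4_3 a = (if a = 1 then 2 else 6)"

text \<open>
  The invariant form on the modified simple roots. In a diagram of finite type, adjacent simple
  roots satisfy \<open>2(\<alpha>|\<beta>)/(\<alpha>|\<alpha>) = -1\<close> with \<open>\<alpha>\<close> the longer of the two.
\<close>

definition form :: "affine_type \<Rightarrow> nat \<Rightarrow> nat \<Rightarrow> real" where
  "form T a b =
     (if a = b then sq_length T a
      else if edge T a b \<or> edge T b a then - max (sq_length T a) (sq_length T b) / 2
      else 0)"

fun untwisted :: "affine_type \<Rightarrow> bool" where
  "untwisted (A1 _) = True"
| "untwisted (B1 _) = True"
| "untwisted (C1 _) = True"
| "untwisted (D1 _) = True"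
| "untwisted E6_1 = True"
| "untwisted F4_1 = True"
| "untwisted G2_1 = True"
| "untwisted _ = False"

definition t_factor :: "affine_type \<Rightarrow> nat \<Rightarrow> real" where
  "t_factor T a = (if untwisted T then 2 / sq_length T a else 1)"

definition t_dual :: "affine_type \<Rightarrow> nat \<Rightarrow> real" where
  "t_dual T a =
     (if untwisted T then 1
      else case T of A2_even _ \<Rightarrow> 2 | _ \<Rightarrow> sq_length T a / 2)"


section \<open>Classical weights\<close>

text \<open>
  A classical weight is given by its coordinates with respect to the fundamental weights
  \<open>\<Lambda>\<^sub>a\<close>, \<open>a \<in> nodes T\<close>, extended by zero. The simple root \<open>\<alpha>\<^sub>a\<close> has coordinates
  \<open>\<langle>\<alpha>\<^sub>c\<^sup>\<or>, \<alpha>\<^sub>a\<rangle> = 2(\<alpha>\<^sub>c|\<alpha>\<^sub>a)/(\<alpha>\<^sub>c|\<alpha>\<^sub>c)\<close>.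
\<close>

definition dominant_weight :: "affine_type \<Rightarrow> (nat \<Rightarrow> int) \<Rightarrow> bool" where
  "dominant_weight T \<mu> \<longleftrightarrow> (\<forall>a\<in>nodes T. 0 \<le> \<mu> a) \<and> (\<forall>a. a \<notin> nodes T \<longrightarrow> \<mu> a = 0)"

definition fundamental_weight :: "nat \<Rightarrow> nat \<Rightarrow> int" where
  "fundamental_weight a = (\<lambda>c. if c = a then 1 else 0)"

definition simple_root :: "affine_type \<Rightarrow> nat \<Rightarrow> nat \<Rightarrow> real" where
  "simple_root T a = (\<lambda>c. if c \<in> nodes T then 2 * form T c a / form T c c else 0)"

text \<open>
  For \<open>A2_even n\<close> this is the linear map from the \<open>C\<^sub>n\<close> to the \<open>B\<^sub>n\<close> weight lattice sending
  \<open>\<Lambda>\<^sub>a\<close> to \<open>\<Lambda>\<^sub>a\<close> for \<open>a < n\<close> and \<open>\<Lambda>\<^sub>n\<close> to \<open>2\<Lambda>\<^sub>n\<close>.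
\<close>

definition weight_map :: "affine_type \<Rightarrow> (nat \<Rightarrow> int) \<Rightarrow> nat \<Rightarrow> int" where
  "weight_map T \<mu> = (case T of A2_even n \<Rightarrow> \<mu>(n := 2 * \<mu> n) | _ \<Rightarrow> \<mu>)"


section \<open>Rigged configurations\<close>

text \<open>
  Matrices \<open>(m\<^sub>i\<^sup>(\<^sup>a\<^sup>))\<close> indexed by \<open>a \<in> nodes T\<close> and \<open>i > 0\<close> are functions \<open>m a i\<close> vanishing
  outside this index set; all sums over positive integers range over the finite support.
\<close>

definition finite_matrix :: "affine_type \<Rightarrow> (nat \<Rightarrow> nat \<Rightarrow> nat) \<Rightarrow> bool" where
  "finite_matrix T m \<longleftrightarrow>
     (\<forall>a i. m a i \<noteq> 0 \<longrightarrow> a \<in> nodes T \<and> 0 < i) \<and> finite {(a, i). m a i \<noteq> 0}"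

definition supp :: "(nat \<Rightarrow> nat) \<Rightarrow> nat set" where
  "supp f = {i. 0 < i \<and> f i \<noteq> 0}"

definition tensor_weight :: "affine_type \<Rightarrow> (nat \<Rightarrow> nat \<Rightarrow> nat) \<Rightarrow> nat \<Rightarrow> int" where
  "tensor_weight T L =
     (\<lambda>c. \<Sum>a\<in>nodes T. \<Sum>i\<in>supp (L a). int i * int (L a i) * fundamental_weight a c)"

definition configuration ::
  "affine_type \<Rightarrow> (nat \<Rightarrow> nat \<Rightarrow> nat) \<Rightarrow> (nat \<Rightarrow> int) \<Rightarrow> (nat \<Rightarrow> nat \<Rightarrow> nat) \<Rightarrow> bool" where
  "configuration T L \<mu> m \<longleftrightarrow>
     finite_matrix T m \<and>
     (\<forall>c\<in>nodes T.
        (\<Sum>a\<in>nodes T. \<Sum>i\<in>supp (m a). real i * real (m a i) * simple_root T a c) =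
        of_int (weight_map T (\<lambda>d. tensor_weight T L d - \<mu> d) c))"

definition vacancy ::
  "affine_type \<Rightarrow> (nat \<Rightarrow> nat \<Rightarrow> nat) \<Rightarrow> (nat \<Rightarrow> nat \<Rightarrow> nat) \<Rightarrow> nat \<Rightarrow> nat \<Rightarrow> real" where
  "vacancy T L m a i =
     (\<Sum>k\<in>supp (L a). real (L a k) * real (min i k)) -
     1 / t_dual T a *
       (\<Sum>b\<in>nodes T. \<Sum>k\<in>supp (m b).
          form T a b * min (t_factor T b * real i) (t_factor T a * real k) * real (m b k))"

definition admissible_configurations ::
  "affine_type \<Rightarrow> (nat \<Rightarrow> nat \<Rightarrow> nat) \<Rightarrow> (nat \<Rightarrow> int) \<Rightarrow> (nat \<Rightarrow> nat \<Rightarrow> nat) set" where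
  "admissible_configurations T L \<mu> =
     {m. configuration T L \<mu> m \<and> (\<forall>a\<in>nodes T. \<forall>i>0. 0 \<le> vacancy T L m a i)}"

text \<open>
  A partition is the multiset of its parts, which are positive. The family of riggings is
  extended by empty partitions outside the index set.
\<close>

type_synonym rigged_configuration = "(nat \<Rightarrow> nat \<Rightarrow> nat) \<times> (nat \<Rightarrow> nat \<Rightarrow> nat multiset)"

definition RC ::
  "affine_type \<Rightarrow> (nat \<Rightarrow> nat \<Rightarrow> nat) \<Rightarrow> (nat \<Rightarrow> int) \<Rightarrow> rigged_configuration set" where
  "RC T L \<mu> =
     {(m, J). m \<in> admissible_configurations T L \<mu> \<and>
        (\<forall>a\<in>nodes T. \<forall>i>0.
           0 \<notin># J a i \<and> size (J a i) \<le> m a i \<and>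
           (\<forall>x\<in>#J a i. real x \<le> vacancy T L m a i)) \<and>
        (\<forall>a i. a \<notin> nodes T \<or> i = 0 \<longrightarrow> J a i = {#})}"

fun cocharge :: "affine_type \<Rightarrow> rigged_configuration \<Rightarrow> real" where
  "cocharge T (m, J) =
     1 / 2 *
       (\<Sum>a\<in>nodes T. \<Sum>b\<in>nodes T. \<Sum>j\<in>supp (m a). \<Sum>k\<in>supp (m b).
          form T a b * min (t_factor T b * real j) (t_factor T a * real k) *
            real (m a j) * real (m b k)) +
     (\<Sum>a\<in>nodes T. \<Sum>i | 0 < i \<and> J a i \<noteq> {#}. t_dual T a * real (\<Sum>\<^sub># (J a i)))"


section \<open>The embeddings\<close>

inductive embedding_pair :: "affine_type \<Rightarrow> affine_type \<Rightarrow> bool" where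
  "2 \<le> n \<Longrightarrow> embedding_pair (C1 n) (A1 (2 * n - 1))"
| "1 \<le> n \<Longrightarrow> embedding_pair (A2_even n) (A1 (2 * n - 1))"
| "2 \<le> n \<Longrightarrow> embedding_pair (D2 n) (A1 (2 * n - 1))"
| "3 \<le> n \<Longrightarrow> embedding_pair (B1 n) (D1 (n + 1))"
| "2 \<le> n \<Longrightarrow> embedding_pair (A2_odd n) (D1 (n + 1))"
| "embedding_pair F4_1 E6_1"
| "embedding_pair E6_2 E6_1"
| "embedding_pair G2_1 (D1 4)"
| "embedding_pair D4_3 (D1 4)"

text \<open>
  Both \<open>iota X\<close> and \<open>gamma X\<close> are meaningful only for the first component \<open>X\<close> of an embedding
  pair, at the nodes \<open>0, \<dots>, classical_rank X\<close>.
\<close>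

fun iota :: "affine_type \<Rightarrow> nat \<Rightarrow> nat set" where
  "iota (C1 n) a = (if 0 < a \<and> a < n then {a, 2 * n - a} else {a})"
| "iota (A2_even n) a = (if 0 < a \<and> a < n then {a, 2 * n - a} else {a})"
| "iota (D2 n) a = (if 0 < a \<and> a < n then {a, 2 * n - a} else {a})"
| "iota (B1 n) a = (if a < n then {a} else {n, n + 1})"
| "iota (A2_odd n) a = (if a < n then {a} else {n, n + 1})"
| "iota F4_1 a =
     (if a = 1 then {6} else if a = 2 then {3} else if a = 3 then {2, 4}
      else if a = 4 then {1, 5} else {a})"
| "iota E6_2 a =
     (if a = 1 then {6} else if a = 2 then {3} else if a = 3 then {2, 4}
      else if a = 4 then {1, 5} else {a})"
| "iota G2_1 a = (if a = 1 then {2} else if a = 2 then {1, 3, 4} else {a})"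
| "iota D4_3 a = (if a = 1 then {2} else if a = 2 then {1, 3, 4} else {a})"
| "iota _ a = {a}"

fun gamma :: "affine_type \<Rightarrow> nat \<Rightarrow> nat" where
  "gamma (C1 n) a = (if a = 0 \<or> a = n then 2 else 1)"
| "gamma (A2_even n) a = (if a = n then 2 else 1)"
| "gamma (B1 n) a = (if a < n then 2 else 1)"
| "gamma F4_1 a = (if a \<le> 2 then 2 else 1)"
| "gamma G2_1 a = (if a \<le> 1 then 3 else 1)"
| "gamma _ a = 1"

definition Psi :: "affine_type \<Rightarrow> (nat \<Rightarrow> int) \<Rightarrow> nat \<Rightarrow> int" where
  "Psi X \<mu> =
     (\<lambda>c. \<Sum>a\<in>nodes X. \<mu> a * (int (gamma X a) * (\<Sum>b\<in>iota X a. fundamental_weight b c)))"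

text \<open>The node \<open>n\<close> of \<open>A\<^sub>2\<^sub>n\<^sup>(\<^sup>2\<^sup>)\<close>, where the virtualization does not dilate indices.\<close>

definition exceptional :: "affine_type \<Rightarrow> nat \<Rightarrow> bool" where
  "exceptional X a \<longleftrightarrow> X = A2_even a"

definition dilation :: "affine_type \<Rightarrow> nat \<Rightarrow> nat" where
  "dilation X a = (if exceptional X a then 1 else gamma X a)"


section \<open>Virtual rigged configurations\<close>

text \<open>The sets \<open>iota X a\<close> for \<open>a \<in> nodes X\<close> partition \<open>nodes Y\<close>.\<close>

definition orbit_index :: "affine_type \<Rightarrow> nat \<Rightarrow> nat" where
  "orbit_index X b = (THE a. a \<in> nodes X \<and> b \<in> iota X a)"

definition virtual_L ::
  "affine_type \<Rightarrow> affine_type \<Rightarrow> (nat \<Rightarrow> nat \<Rightarrow> nat) \<Rightarrow> nat \<Rightarrow> nat \<Rightarrow> nat" where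
  "virtual_L X Y L b j =
     (if b \<in> nodes Y then
        (let a = orbit_index X b in
         if exceptional X a then 2 * L a j
         else if gamma X a dvd j then L a (j div gamma X a)
         else 0)
      else 0)"

text \<open>
  The symmetry condition and the divisibility conditions refer to the orbits \<open>iota X a\<close>.
  The vanishing condition on \<open>m\<close> uses the dilation factor of the index, which differs from
  \<open>\<gamma>\<^sub>a\<close> exactly at the exceptional node of \<open>A\<^sub>2\<^sub>n\<^sup>(\<^sup>2\<^sup>)\<close>: there \<open>\<gamma>\<^sub>n = 2\<close>, but odd indices are
  allowed, as the virtualization map sends \<open>m\<^sub>i\<^sup>(\<^sup>n\<^sup>)\<close> to index \<open>i\<close>. The riggings are
  multiples of \<open>\<gamma>\<^sub>a\<close> at every node.
\<close>

definition RC_virtual ::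
  "affine_type \<Rightarrow> affine_type \<Rightarrow> (nat \<Rightarrow> nat \<Rightarrow> nat) \<Rightarrow> (nat \<Rightarrow> int) \<Rightarrow>
   rigged_configuration set" where
  "RC_virtual X Y L \<mu> =
     {(m, J) \<in> RC Y (virtual_L X Y L) (Psi X \<mu>).
        (\<forall>a\<in>nodes X. \<forall>b\<in>iota X a. \<forall>b'\<in>iota X a. \<forall>i>0. m b i = m b' i \<and> J b i = J b' i) \<and>
        (\<forall>a\<in>nodes X. \<forall>b\<in>iota X a. \<forall>i>0.
           (\<not> dilation X a dvd i \<longrightarrow> m b i = 0) \<and> (\<forall>x\<in>#J b i. gamma X a dvd x))}"

definition scale_partition :: "nat \<Rightarrow> nat multiset \<Rightarrow> nat multiset" where
  "scale_partition g J = image_mset (\<lambda>x. g * x) J"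

text \<open>
  The last condition says that all entries not prescribed by the first one are trivial; hence
  \<open>virtualizes X\<close> determines its second argument from the first.
\<close>

fun virtualizes ::
  "affine_type \<Rightarrow> rigged_configuration \<Rightarrow> rigged_configuration \<Rightarrow> bool" where
  "virtualizes X (m, J) (m', J') \<longleftrightarrow>
     (\<forall>a\<in>nodes X. \<forall>b\<in>iota X a. \<forall>i>0.
        m' b (dilation X a * i) = m a i \<and>
        J' b (dilation X a * i) = scale_partition (gamma X a) (J a i)) \<and>
     (\<forall>b j. \<not> (\<exists>a\<in>nodes X. \<exists>i>0. b \<in> iota X a \<and> j = dilation X a * i) \<longrightarrow>
        m' b j = 0 \<and> J' b j = {#})"

end

theory Submission
  imports Defs
begin

text \<open>
  All types \<open>Y\<close> are simply laced, and the Dynkin diagram of \<open>X\<close> is obtained from that of \<open>Y\<close> by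
  folding along the orbits \<open>iota X a\<close>. The virtualization map copies row \<open>a\<close> of a rigged
  configuration to every row in the orbit of \<open>a\<close>, stretching the indices by \<open>d\<^sub>a = dilation X a\<close>
  and the riggings by \<open>\<gamma>\<^sub>a = gamma X a\<close>. Everything reduces to three numerical relations between
  \<open>X\<close> and \<open>Y\<close>, which are verified type by type: \<open>d\<^sub>a t\<^sub>a\<close> does not depend on \<open>a\<close>
  (\<open>dilation_t_factor\<close>); summing the form of \<open>Y\<close> over an orbit gives the form of \<open>X\<close>,
  \<open>d\<^sub>a \<Sum>\<^sub>b\<^sub>' (\<alpha>\<^sub>b|\<alpha>\<^sub>b\<^sub>') = \<gamma>\<^sub>a / t\<^sub>a\<^sup>\<or> (\<alpha>\<^sub>a|\<alpha>\<^sub>a\<^sub>') t\<^sub>a\<^sub>'\<close> with \<open>b\<close> in the orbit of \<open>a\<close> and \<open>b'\<close> ranging over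
  the orbit of \<open>a'\<close> (\<open>folded_form\<close>); and the orbit of \<open>a\<close> has
  \<open>\<gamma>\<^sub>0 t\<^sub>a\<^sup>\<or> / \<gamma>\<^sub>a\<close> elements (\<open>card_iota\<close>).

  The first two relations turn \<open>(\<alpha>\<^sub>b|\<alpha>\<^sub>b\<^sub>') min(d\<^sub>a i, d\<^sub>a\<^sub>' k)\<close>, summed over an orbit, into a multiple
  of \<open>(\<alpha>\<^sub>a|\<alpha>\<^sub>a\<^sub>') min(t\<^sub>a\<^sub>' i, t\<^sub>a k)\<close>. So the weight equations for \<open>X\<close> and \<open>Y\<close> are equivalent
  (\<open>configuration_spread\<close>), and the vacancy number of the image at \<open>d\<^sub>a i\<close> is \<open>\<gamma>\<^sub>a\<close> times that of
  the source at \<open>i\<close> (\<open>vacancy_dilated\<close>), which is the scaling of the bounds on the riggings.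
  The third relation then gives the factor \<open>\<gamma>\<^sub>0\<close> for the cocharge (\<open>cocharge_spread\<close>).

  Admissibility for \<open>Y\<close> also concerns the vacancy numbers at indices which are not multiples of
  \<open>d\<^sub>a\<close>, about which \<open>X\<close> says nothing. Between two consecutive multiples of \<open>d\<^sub>a\<close> the row \<open>b\<close> itself
  has no entries, and the other rows enter the vacancy number with nonnegative coefficients, so the
  vacancy number is concave there and is nonnegative because it is so at the two end points
  (\<open>vacancy_interpolation\<close>).

  Finally, the image is all of \<open>RC_virtual X Y L \<mu>\<close>: the symmetry and divisibility conditions
  allow to read off a preimage from one representative of each orbit (\<open>virtualization_onto\<close>). Where
  the matrix vanishes the riggings are empty, so no information is lost off the multiples of \<open>d\<^sub>a\<close>.
\<close>

section \<open>Matrices, partitions and the minimum function\<close>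

lemma finite_nodes: "finite (nodes T)" by (simp add: nodes_def)

lemma finite_matrix_iff:
  assumes "\<forall>a i. m a i \<noteq> 0 \<longrightarrow> a \<in> nodes T \<and> 0 < i"
  shows "finite_matrix T m \<longleftrightarrow> (\<forall>a\<in>nodes T. finite (supp (m a)))"
proof -
  have "{(a, i). m a i \<noteq> 0} = (SIGMA a:nodes T. supp (m a))"
    using assms by (auto simp: supp_def)
  moreover have "supp (m a) \<subseteq> snd ` {(a, i). m a i \<noteq> 0}" for a
    by (force simp: supp_def)
  then have "finite {(a, i). m a i \<noteq> 0} \<Longrightarrow> finite (supp (m a))" for a
    by (meson finite_imageI finite_subset)
  ultimately show ?thesis
    using assms finite_nodes[of T] by (auto simp: finite_matrix_def intro!: finite_SigmaI)
qed

lemma RC_supported: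
  assumes "(m, J) \<in> RC T L \<mu>"
  shows "m a i \<noteq> 0 \<Longrightarrow> a \<in> nodes T \<and> 0 < i"
    and "a \<notin> nodes T \<or> i = 0 \<Longrightarrow> m a i = 0"
    and "a \<notin> nodes T \<or> i = 0 \<Longrightarrow> J a i = {#}"
    and "a \<in> nodes T \<Longrightarrow> m a i = 0 \<Longrightarrow> J a i = {#}"
proof -
  have *: "finite_matrix T m" "\<forall>a\<in>nodes T. \<forall>i>0. size (J a i) \<le> m a i"
    and J: "\<forall>a i. a \<notin> nodes T \<or> i = 0 \<longrightarrow> J a i = {#}"
    using assms by (auto simp: RC_def admissible_configurations_def configuration_def)
  show "m a i \<noteq> 0 \<Longrightarrow> a \<in> nodes T \<and> 0 < i"
    "a \<notin> nodes T \<or> i = 0 \<Longrightarrow> m a i = 0"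
    using * by (auto simp: finite_matrix_def)
  show "a \<notin> nodes T \<or> i = 0 \<Longrightarrow> J a i = {#}" using J by blast
  show "J a i = {#}" if "a \<in> nodes T" "m a i = 0"
  proof (cases "i = 0")
    case False
    then have "size (J a i) \<le> m a i" using * that by blast
    then show ?thesis using that by simp
  qed (use J in blast)
qed

lemma tensor_weight_eq:
  "c \<in> nodes T \<Longrightarrow> tensor_weight T L c = (\<Sum>i\<in>supp (L c). int i * int (L c i))"
proof -
  assume c: "c \<in> nodes T"
  have "tensor_weight T L c = (\<Sum>a\<in>nodes T. if c = a then (\<Sum>i\<in>supp (L a). int i * int (L a i)) else 0)"
    unfolding tensor_weight_def fundamental_weight_def by (intro sum.cong) auto
  then show ?thesis using c finite_nodes[of T] by simp
qed

lemma scale_partition_inject: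
  assumes "0 < g" "scale_partition g J = scale_partition g J'"
  shows "J = J'"
proof -
  have "image_mset (\<lambda>x. x div g) (scale_partition g I) = I" for I
    using assms(1) by (simp add: scale_partition_def multiset.map_comp o_def)
  then show ?thesis using assms(2) by metis
qed

lemma scale_partition_div:
  assumes "\<forall>x\<in>#J. g dvd x"
  shows "scale_partition g (image_mset (\<lambda>x. x div g) J) = J"
proof -
  have "scale_partition g (image_mset (\<lambda>x. x div g) J) = image_mset (\<lambda>x. x) J"
    unfolding scale_partition_def multiset.map_comp o_def
    using assms by (intro image_mset_cong) auto
  then show ?thesis by simp
qed

lemma sum_scale_partition: "\<Sum>\<^sub># (scale_partition g J) = g * \<Sum>\<^sub># J"
  by (induct J) (simp_all add: scale_partition_def algebra_simps)

text \<open>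
  The function \<open>j \<mapsto> min j k\<close> is concave, so on the interval from \<open>d q\<close> to \<open>d q + d\<close> it lies above its
  chord; its only kink is at \<open>k\<close>, so it agrees with the chord if \<open>k\<close> is a multiple of \<open>d\<close>. This is
  what controls vacancy numbers at indices between two multiples of the dilation factor.
\<close>

lemma min_interpolation:
  fixes d q s k :: nat
  assumes "s \<le> d"
  shows "real (d - s) * real (min (d * q) k) + real s * real (min (d * q + d) k)
         \<le> real d * real (min (d * q + s) k)"
proof -
  consider "k \<le> d * q" | "d * q + d \<le> k" | "d * q < k" "k < d * q + d" by linarith
  then show ?thesis
  proof cases
    case 1
    then show ?thesis using assms by (simp add: algebra_simps of_nat_diff)
  next
    case 2
    then show ?thesis using assms by (simp add: algebra_simps of_nat_diff)
  next
    case 3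
    show ?thesis
    proof (cases "k \<le> d * q + s")
      case True
      have "real (d - s) * real (d * q) \<le> real (d - s) * real k"
        using 3 by (intro mult_left_mono of_nat_mono) auto
      then show ?thesis using 3 True assms by (simp add: algebra_simps of_nat_diff)
    next
      case False
      have "real s * real k \<le> real s * real (d * q + d)"
        using 3 by (intro mult_left_mono of_nat_mono) auto
      then show ?thesis using 3 False assms by (simp add: algebra_simps of_nat_diff)
    qed
  qed
qed

lemma min_interpolation_dvd:
  fixes d q s k :: nat
  assumes "s \<le> d" "d dvd k"
  shows "real (d - s) * real (min (d * q) k) + real s * real (min (d * q + d) k)
         = real d * real (min (d * q + s) k)"
proof -
  obtain l where l: "k = d * l" using assms(2) ..
  consider "l \<le> q" | "Suc q \<le> l" by linarith
  then have "k \<le> d * q \<or> d * q + d \<le> k"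
    using mult_le_mono2[of l q d] mult_le_mono2[of "Suc q" l d] by cases (auto simp: l)
  then show ?thesis
  proof
    assume "k \<le> d * q"
    then show ?thesis using assms(1) by (simp add: algebra_simps of_nat_diff)
  next
    assume "d * q + d \<le> k"
    then show ?thesis using assms(1) by (simp add: algebra_simps of_nat_diff)
  qed
qed

section \<open>Folding the diagrams of types A and D\<close>

text \<open>
  The orbits of the reflection of the chain \<open>1, \<dots>, 2 n - 1\<close> in its middle node \<open>n\<close>.
\<close>

definition chain_orbit :: "nat \<Rightarrow> nat \<Rightarrow> nat set" where
  "chain_orbit n a = (if 0 < a \<and> a < n then {a, 2 * n - a} else {a})"

text \<open>
  The orbits of the exchange of the two end nodes \<open>n\<close> and \<open>n + 1\<close> of the fork of \<open>D\<^sub>n\<^sub>+\<^sub>1\<close>.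
\<close>

definition fork_orbit :: "nat \<Rightarrow> nat \<Rightarrow> nat set" where
  "fork_orbit n a = (if a < n then {a} else {n, n + 1})"

lemma UN_chain_orbit:
  assumes "1 \<le> n"
  shows "(\<Union>a\<in>{1..n}. chain_orbit n a) = {1..2 * n - 1}"
proof (intro equalityI subsetI)
  fix b assume "b \<in> {1..2 * n - 1}"
  then show "b \<in> (\<Union>a\<in>{1..n}. chain_orbit n a)"
    unfolding chain_orbit_def by (intro UN_I[of "min b (2 * n - b)"]) auto
qed (use assms in \<open>auto simp: chain_orbit_def split: if_splits\<close>)

lemma UN_fork_orbit:
  assumes "1 \<le> n"
  shows "(\<Union>a\<in>{1..n}. fork_orbit n a) = {1..n + 1}"
proof (intro equalityI subsetI)
  fix b assume "b \<in> {1..n + 1}"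
  then show "b \<in> (\<Union>a\<in>{1..n}. fork_orbit n a)"
    using assms unfolding fork_orbit_def by (intro UN_I[of "min b n"]) auto
qed (use assms in \<open>auto simp: fork_orbit_def split: if_splits\<close>)

text \<open>
  The two halves of the chain are symmetric, so \<open>b\<close> may be replaced by \<open>a\<close>. The middle node has both
  nodes of the neighbouring orbit as neighbours, which produces the double bond; all other bonds
  stay simple.
\<close>

lemma sum_form_chain_orbit:
  assumes "a \<in> {1..n}" "a' \<in> {1..n}" "b \<in> chain_orbit n a"
  shows "(\<Sum>b'\<in>chain_orbit n a'. form (A1 N) b b') =
    (if a = a' then 2 else if a' = Suc a then -1
     else if a = Suc a' then (if a = n then -2 else -1) else 0)"
proof -
  have f: "form (A1 N) c c' = (if c = c' then 2 else if c' = c + 1 \<or> c = c' + 1 then -1 else 0)"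
    for c c'
    by (simp add: form_def)
  \<comment> \<open>the two halves of the chain are joined only through the middle node \<open>n\<close>\<close>
  have opposite: "form (A1 N) c (2 * n - c') = (if c = n \<and> Suc c' = n then -1 else 0)"
    if "c \<le> n" "c' < n" for c c'
  proof -
    have "c \<noteq> 2 * n - c'" "c \<noteq> 2 * n - c' + 1" "2 * n - c' = c + 1 \<longleftrightarrow> c = n \<and> Suc c' = n"
      using that by arith+
    then show ?thesis unfolding f by simp
  qed
  have reflect: "form (A1 N) (2 * n - c) c' = form (A1 N) c (2 * n - c')"
    if "c \<le> n" "c' \<le> n" for c c'
  proof -
    have "2 * n - c = c' \<longleftrightarrow> c = 2 * n - c'" "c' = 2 * n - c + 1 \<longleftrightarrow> c = 2 * n - c' + 1"
      "2 * n - c = c' + 1 \<longleftrightarrow> 2 * n - c' = c + 1"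
      using that by arith+
    then show ?thesis unfolding f by auto
  qed
  have reflect': "form (A1 N) (2 * n - c) (2 * n - c') = form (A1 N) c c'"
    if "c \<le> n" "c' \<le> n" for c c'
  proof -
    have "2 * n - c = 2 * n - c' \<longleftrightarrow> c = c'" "2 * n - c' = 2 * n - c + 1 \<longleftrightarrow> c = c' + 1"
      "2 * n - c = 2 * n - c' + 1 \<longleftrightarrow> c' = c + 1"
      using that by arith+
    then show ?thesis unfolding f by auto
  qed
  have b: "b = a \<or> a < n \<and> b = 2 * n - a"
    using assms by (auto simp: chain_orbit_def split: if_splits)
  show ?thesis
  proof (cases "a' < n")
    case True
    then have "a' \<noteq> 2 * n - a'" by arith
    with True have "(\<Sum>b'\<in>chain_orbit n a'. form (A1 N) b b') =
        form (A1 N) b a' + form (A1 N) b (2 * n - a')"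
      using assms(2) by (simp add: chain_orbit_def)
    also have "\<dots> = form (A1 N) a a' + form (A1 N) a (2 * n - a')"
      using assms(1,2) b reflect[of a a'] reflect'[of a a'] by auto
    finally show ?thesis
      using assms(1,2) True opposite[of a a'] by (simp add: f)
  next
    case False
    then have "(\<Sum>b'\<in>chain_orbit n a'. form (A1 N) b b') = form (A1 N) b n" "a' = n"
      using assms(2) by (simp_all add: chain_orbit_def)
    moreover have "form (A1 N) b n = form (A1 N) a n"
      using assms(1) b reflect[of a n] by (auto simp: mult_2)
    ultimately show ?thesis
      using assms(1) by (simp add: f)
  qed
qed

text \<open>
  Here the branch node \<open>n - 1\<close> is joined to both nodes of the last orbit, whereas each of these is
  joined to the branch node only: the double bond points the other way.
\<close>

lemma sum_form_fork_orbit: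
  assumes "a \<in> {1..n}" "a' \<in> {1..n}" "b \<in> fork_orbit n a"
  shows "(\<Sum>b'\<in>fork_orbit n a'. form (D1 (Suc n)) b b') =
    (if a = a' then 2 else if a' = Suc a then (if a' = n then -2 else -1)
     else if a = Suc a' then -1 else 0)"
proof -
  have f: "form (D1 (Suc n)) c c' = (if c = c' then 2
      else if c' = c + 1 \<and> c' \<le> n \<or> c' = c + 2 \<and> c' = n + 1 \<or>
              c = c' + 1 \<and> c \<le> n \<or> c = c' + 2 \<and> c = n + 1 then -1 else 0)" for c c'
    by (simp add: form_def less_Suc_eq_le)
  have diag: "form (D1 (Suc n)) c c = 2" for c
    by (simp add: f)
  have tip: "form (D1 (Suc n)) c (Suc n) = (if Suc c = n then -1 else 0)"
    "form (D1 (Suc n)) (Suc n) c = (if Suc c = n then -1 else 0)" if "c \<le> n" for c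
    using that by (simp_all add: f)
  have b: "b = a \<or> a = n \<and> b = n + 1"
    using assms by (auto simp: fork_orbit_def split: if_splits)
  show ?thesis
  proof (cases "a' < n")
    case True
    then have "(\<Sum>b'\<in>fork_orbit n a'. form (D1 (Suc n)) b b') = form (D1 (Suc n)) b a'"
      by (simp add: fork_orbit_def)
    also have "\<dots> = form (D1 (Suc n)) a a'"
    proof (cases "b = a")
      case False
      then have "a = n" "b = n + 1" using b by auto
      then show ?thesis using True tip(2)[of a'] by (simp add: f)
    qed simp
    finally show ?thesis
      using assms(1,2) True by (simp add: f)
  next
    case False
    then have a': "a' = n"
      using assms(2) by simp
    then have "(\<Sum>b'\<in>fork_orbit n a'. form (D1 (Suc n)) b b') =
        form (D1 (Suc n)) b n + form (D1 (Suc n)) b (n + 1)"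
      by (simp add: fork_orbit_def)
    also have "\<dots> = form (D1 (Suc n)) a n + form (D1 (Suc n)) a (n + 1)"
    proof (cases "b = a")
      case False
      then have "a = n" "b = n + 1" using b by auto
      then show ?thesis by (simp add: tip diag)
    qed simp
    finally show ?thesis
      using assms(1) a' tip(1)[of a] by (simp add: f)
  qed
qed

section \<open>Numerical relations between the two types\<close>

locale embedding =
  fixes X Y :: affine_type
  assumes pair: "embedding_pair X Y"
begin

lemma nodes_Y: "nodes Y = (\<Union>a\<in>nodes X. iota X a)"
  using pair
proof cases
  case (1 n)
  then show ?thesis using UN_chain_orbit[of n] by (simp add: nodes_def chain_orbit_def)
next
  case (2 n)
  then show ?thesis using UN_chain_orbit[of n] by (simp add: nodes_def chain_orbit_def)
next
  case (3 n)
  then show ?thesis using UN_chain_orbit[of n] by (simp add: nodes_def chain_orbit_def)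
next
  case (4 n)
  then show ?thesis using UN_fork_orbit[of n] by (simp add: nodes_def fork_orbit_def)
next
  case (5 n)
  then show ?thesis using UN_fork_orbit[of n] by (simp add: nodes_def fork_orbit_def)
qed (auto simp: nodes_def atLeastAtMostSuc_conv numeral_eq_Suc)

lemma iota_disjoint:
  assumes "a \<in> nodes X" "a' \<in> nodes X" "b \<in> iota X a" "b \<in> iota X a'"
  shows "a = a'"
  using pair assms
  by cases (auto simp: nodes_def split: if_splits)

lemma iota_finite: "finite (iota X a)"
  using pair by cases auto

lemma iota_nonempty: "iota X a \<noteq> {}"
  using pair by cases auto

lemma orbit_index_eq:
  assumes "a \<in> nodes X" "b \<in> iota X a"
  shows "orbit_index X b = a"
  unfolding orbit_index_def using assms iota_disjoint by blast

lemma all_nodes_Y: "(\<forall>b\<in>nodes Y. P b) \<longleftrightarrow> (\<forall>a\<in>nodes X. \<forall>b\<in>iota X a. P b)"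
  by (auto simp: nodes_Y)

lemma all_nodes_Y_iff:
  assumes "\<And>a b. a \<in> nodes X \<Longrightarrow> b \<in> iota X a \<Longrightarrow> P b \<longleftrightarrow> Q a"
  shows "(\<forall>b\<in>nodes Y. P b) \<longleftrightarrow> (\<forall>a\<in>nodes X. Q a)"
  unfolding all_nodes_Y using assms iota_nonempty by blast

lemma sum_nodes_Y: "(\<Sum>b\<in>nodes Y. f b) = (\<Sum>a\<in>nodes X. \<Sum>b\<in>iota X a. f b)"
  unfolding nodes_Y
  by (rule sum.UNION_disjoint) (use iota_disjoint iota_finite finite_nodes in blast)+

lemma gamma_pos: "gamma X a > 0"
  using pair by cases auto

lemma dilation_pos [simp]: "dilation X a > 0"
  using gamma_pos by (simp add: dilation_def)

lemma dilation_nonzero [simp]: "dilation X a \<noteq> 0"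
  using dilation_pos[of a] by simp

text \<open>
  The quotient of \<open>gamma X a\<close> by \<open>dilation X a\<close>. It is not 1 exactly where the weights, the
  multiplicities of the tensor factors and the riggings are doubled while the indices are not
  stretched, and it is also the factor in \<open>weight_map\<close>.
\<close>

definition doubling :: "nat \<Rightarrow> nat" where
  "doubling a = (if exceptional X a then 2 else 1)"

lemma doubling_pos: "doubling a > 0" by (simp add: doubling_def)

lemma doubling_dilation: "a \<in> nodes X \<Longrightarrow> doubling a * dilation X a = gamma X a"
  by (auto simp: doubling_def dilation_def exceptional_def)

lemma t_dual_pos: "a \<in> nodes X \<Longrightarrow> t_dual X a > 0"
  using pair by cases (auto simp: t_dual_def)

lemma t_factor_pos: "t_factor X a > 0"
  using pair by cases (auto simp: t_factor_def)

lemma sq_length_pos: "sq_length X a > 0"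
  using pair by cases auto

lemma simply_laced:
  shows "sq_length Y b = 2" and "t_factor Y b = 1" and "t_dual Y b = 1"
proof -
  show "sq_length Y b = 2" using pair by cases simp_all
  show "t_factor Y b = 1" using pair by cases (simp_all add: t_factor_def)
  show "t_dual Y b = 1" using pair by cases (simp_all add: t_dual_def)
qed

lemma form_Y_offdiag: "b \<noteq> b' \<Longrightarrow> form Y b b' \<le> 0"
  by (simp add: form_def simply_laced)

text \<open>
  The factors \<open>t\<^sub>a\<close> serve to compare indices of different rows of \<open>X\<close>. In \<open>Y\<close> they are all 1, and the
  comparison is instead brought about by stretching the indices.
\<close>

lemma dilation_t_factor:
  assumes "a \<in> nodes X" "a' \<in> nodes X"
  shows "real (dilation X a) * t_factor X a = real (dilation X a') * t_factor X a'"
  using pair assms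
  by cases (auto simp: dilation_def exceptional_def t_factor_def nodes_def)

text \<open>
  For \<open>a \<noteq> a'\<close> the sum is minus the number of neighbours of \<open>b\<close> in the orbit of \<open>a'\<close>, and this number
  is the one that the bond between \<open>a\<close> and \<open>a'\<close> prescribes as a Cartan integer. No two nodes of one
  orbit are adjacent, so for \<open>a = a'\<close> the sum is just the squared length 2. The factors \<open>\<gamma>\<close>, \<open>t\<close> and
  \<open>t\<^sup>\<or>\<close> compensate the different normalizations of the form.
\<close>

lemma folded_form:
  assumes "a \<in> nodes X" "a' \<in> nodes X" "b \<in> iota X a"
  shows "real (dilation X a) * (\<Sum>b'\<in>iota X a'. form Y b b') =
    real (gamma X a) / t_dual X a * form X a a' * t_factor X a'"
proof -
  note data = t_dual_def t_factor_def dilation_def exceptional_def form_def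
  show ?thesis
    using pair
  proof cases
    case (1 n)
    have orbit: "iota (C1 n) = chain_orbit n"
      by (intro ext) (simp add: chain_orbit_def)
    have nodes: "nodes (C1 n) = {1..n}"
      by (simp add: nodes_def)
    have *: "(\<Sum>b'\<in>chain_orbit n a'. form (A1 (2 * n - 1)) b b') =
      (if a = a' then 2 else if a' = Suc a then -1
       else if a = Suc a' then (if a = n then -2 else -1) else 0)"
      using assms unfolding 1 orbit nodes by (rule sum_form_chain_orbit)
    show ?thesis
      using assms(1,2) unfolding 1 orbit * nodes
      by (cases "a = n"; cases "a' = n"; simp add: data)
  next
    case (2 n)
    have orbit: "iota (A2_even n) = chain_orbit n"
      by (intro ext) (simp add: chain_orbit_def)
    have nodes: "nodes (A2_even n) = {1..n}"
      by (simp add: nodes_def)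
    have *: "(\<Sum>b'\<in>chain_orbit n a'. form (A1 (2 * n - 1)) b b') =
      (if a = a' then 2 else if a' = Suc a then -1
       else if a = Suc a' then (if a = n then -2 else -1) else 0)"
      using assms unfolding 2 orbit nodes by (rule sum_form_chain_orbit)
    show ?thesis
      using assms(1,2) unfolding 2 orbit * nodes
      by (cases "a = n"; cases "a' = n"; simp add: data)
  next
    case (3 n)
    have orbit: "iota (D2 n) = chain_orbit n"
      by (intro ext) (simp add: chain_orbit_def)
    have nodes: "nodes (D2 n) = {1..n}"
      by (simp add: nodes_def)
    have *: "(\<Sum>b'\<in>chain_orbit n a'. form (A1 (2 * n - 1)) b b') =
      (if a = a' then 2 else if a' = Suc a then -1
       else if a = Suc a' then (if a = n then -2 else -1) else 0)"
      using assms unfolding 3 orbit nodes by (rule sum_form_chain_orbit)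
    show ?thesis
      using assms(1,2) unfolding 3 orbit * nodes
      by (cases "a = n"; cases "a' = n"; simp add: data)
  next
    case (4 n)
    have orbit: "iota (B1 n) = fork_orbit n"
      by (intro ext) (simp add: fork_orbit_def)
    have nodes: "nodes (B1 n) = {1..n}"
      by (simp add: nodes_def)
    have *: "(\<Sum>b'\<in>fork_orbit n a'. form (D1 (Suc n)) b b') =
      (if a = a' then 2 else if a' = Suc a then (if a' = n then -2 else -1)
       else if a = Suc a' then -1 else 0)"
      using assms unfolding 4 orbit nodes Suc_eq_plus1[symmetric] by (rule sum_form_fork_orbit)
    show ?thesis
      using assms(1,2) unfolding 4 orbit Suc_eq_plus1[symmetric] * nodes
      by (cases "a = n"; cases "a' = n"; simp add: data)
  next
    case (5 n)
    have orbit: "iota (A2_odd n) = fork_orbit n"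
      by (intro ext) (simp add: fork_orbit_def)
    have nodes: "nodes (A2_odd n) = {1..n}"
      by (simp add: nodes_def)
    have *: "(\<Sum>b'\<in>fork_orbit n a'. form (D1 (Suc n)) b b') =
      (if a = a' then 2 else if a' = Suc a then (if a' = n then -2 else -1)
       else if a = Suc a' then -1 else 0)"
      using assms unfolding 5 orbit nodes Suc_eq_plus1[symmetric] by (rule sum_form_fork_orbit)
    show ?thesis
      using assms(1,2) unfolding 5 orbit Suc_eq_plus1[symmetric] * nodes
      by (cases "a = n"; cases "a' = n"; simp add: data)
  next
    case 6
    have "a \<in> {1, 2, 3, 4}" "a' \<in> {1, 2, 3, 4}"
      using assms(1,2) by (auto simp: 6 nodes_def)
    then show ?thesis
      using assms(3) unfolding 6 by (elim insertE emptyE) (auto simp: data)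
  next
    case 7
    have "a \<in> {1, 2, 3, 4}" "a' \<in> {1, 2, 3, 4}"
      using assms(1,2) by (auto simp: 7 nodes_def)
    then show ?thesis
      using assms(3) unfolding 7 by (elim insertE emptyE) (auto simp: data)
  next
    case 8
    have "a \<in> {1, 2}" "a' \<in> {1, 2}"
      using assms(1,2) by (auto simp: 8 nodes_def)
    then show ?thesis
      using assms(3) unfolding 8 by (elim insertE emptyE) (auto simp: data)
  next
    case 9
    have "a \<in> {1, 2}" "a' \<in> {1, 2}"
      using assms(1,2) by (auto simp: 9 nodes_def)
    then show ?thesis
      using assms(3) unfolding 9 by (elim insertE emptyE) (auto simp: data)
  qed
qed

text \<open>
  The linear term of the cocharge is repeated once for each node of the orbit and its parts are
  multiplied by \<open>\<gamma>\<^sub>a\<close>. This relation makes the outcome the same multiple \<open>\<gamma>\<^sub>0\<close> of \<open>t\<^sub>a\<^sup>\<or>\<close> in all rows.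
\<close>

lemma card_iota:
  assumes "a \<in> nodes X"
  shows "real (card (iota X a)) * real (gamma X a) = real (gamma X 0) * t_dual X a"
  using pair assms
  by cases (auto simp: t_dual_def nodes_def card_insert_if)

text \<open>
  Since \<open>simple_root X a c\<close> is \<open>2 (\<alpha>\<^sub>c|\<alpha>\<^sub>a) / (\<alpha>\<^sub>c|\<alpha>\<^sub>c)\<close>, this converts the factor
  \<open>t\<^sub>c / t\<^sub>c\<^sup>\<or>\<close> produced by \<open>folded_form\<close> into the normalization of the simple roots.
\<close>

lemma weight_scale:
  assumes "a \<in> nodes X"
  shows "t_factor X a / t_dual X a * sq_length X a * (if exceptional X a then 2 else 1) = 2"
  using pair assms
  by cases (auto simp: t_dual_def t_factor_def nodes_def exceptional_def)

lemma weight_map_X: "weight_map X \<nu> a = int (doubling a) * \<nu> a"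
  unfolding weight_map_def doubling_def exceptional_def by (cases X) auto

lemma weight_map_Y: "weight_map Y \<nu> = \<nu>"
  using pair by cases (auto simp: weight_map_def)

section \<open>Spreading a matrix over the orbits\<close>

text \<open>
  The common part of the virtualization of matrices and of riggings: row \<open>a\<close> is copied to each row
  of its orbit with stretched indices. For multisets \<open>0\<close> is the empty partition, so both kinds of
  data are instances.
\<close>

definition spread :: "(nat \<Rightarrow> nat \<Rightarrow> 'a::zero) \<Rightarrow> nat \<Rightarrow> nat \<Rightarrow> 'a" where
  "spread f b j =
     (if \<exists>a\<in>nodes X. \<exists>i>0. b \<in> iota X a \<and> j = dilation X a * i
      then f (orbit_index X b) (j div dilation X (orbit_index X b)) else 0)"

lemma spread_dilated:
  assumes "a \<in> nodes X" "b \<in> iota X a" "0 < i"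
  shows "spread f b (dilation X a * i) = f a i"
proof -
  have "\<exists>a'\<in>nodes X. \<exists>i'>0. b \<in> iota X a' \<and> dilation X a * i = dilation X a' * i'"
    using assms by blast
  then show ?thesis
    using assms by (simp add: spread_def orbit_index_eq)
qed

lemma spread_outside:
  assumes "\<not> (\<exists>a\<in>nodes X. \<exists>i>0. b \<in> iota X a \<and> j = dilation X a * i)"
  shows "spread f b j = 0"
  unfolding spread_def using assms by (rule if_not_P)

lemma spread_not_dvd:
  assumes "a \<in> nodes X" "b \<in> iota X a" "\<not> dilation X a dvd j \<or> j = 0"
  shows "spread f b j = 0"
proof (rule spread_outside, clarify)
  fix a' i assume "a' \<in> nodes X" "0 < i" "b \<in> iota X a'" "j = dilation X a' * i"
  then show False
    using assms iota_disjoint[of a' a b] dilation_pos[of a] by auto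
qed

lemma spread_unsupported: "b \<notin> nodes Y \<or> j = 0 \<Longrightarrow> spread f b j = 0"
  by (intro spread_outside) (auto simp: nodes_Y)

text \<open>
  A family is a spread one if it is constant along orbits and supported on the stretched index
  set. This recognizes the virtual rigged configurations as images.
\<close>

lemma spread_eqI:
  assumes "\<And>a b i. a \<in> nodes X \<Longrightarrow> b \<in> iota X a \<Longrightarrow> 0 < i \<Longrightarrow> f a i = g b (dilation X a * i)"
    and "\<And>a b j. a \<in> nodes X \<Longrightarrow> b \<in> iota X a \<Longrightarrow> 0 < j \<Longrightarrow> \<not> dilation X a dvd j \<Longrightarrow> g b j = 0"
    and "\<And>b j. b \<notin> nodes Y \<or> j = 0 \<Longrightarrow> g b j = 0"
  shows "spread f = g"
proof (intro ext)
  fix b j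
  show "spread f b j = g b j"
  proof (cases "b \<notin> nodes Y \<or> j = 0")
    case True
    then show ?thesis using assms(3) by (simp add: spread_unsupported)
  next
    case False
    then obtain a where ab: "a \<in> nodes X" "b \<in> iota X a" by (auto simp: nodes_Y)
    show ?thesis
    proof (cases "dilation X a dvd j")
      case True
      then obtain i where "j = dilation X a * i" "0 < i" using False by auto
      then show ?thesis using ab assms(1) by (simp add: spread_dilated)
    next
      case not_dvd: False
      then show ?thesis using ab False assms(2) by (simp add: spread_not_dvd)
    qed
  qed
qed

lemma spread_inject:
  assumes "\<And>a i. a \<notin> nodes X \<or> i = 0 \<Longrightarrow> f a i = 0"
    and "\<And>a i. a \<notin> nodes X \<or> i = 0 \<Longrightarrow> g a i = 0"
    and eq: "spread f = spread g"
  shows "f = g"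
proof (intro ext)
  fix a i
  show "f a i = g a i"
  proof (cases "a \<notin> nodes X \<or> i = 0")
    case True
    then show ?thesis using assms by simp
  next
    case False
    obtain b where "b \<in> iota X a" using iota_nonempty by blast
    then show ?thesis
      using False spread_dilated[of a b i f] spread_dilated[of a b i g] eq by simp
  qed
qed

lemma supp_spread:
  assumes "a \<in> nodes X" "b \<in> iota X a"
  shows "supp (spread m b) = (\<lambda>i. dilation X a * i) ` supp (m a)"
proof (intro equalityI subsetI)
  fix j assume j: "j \<in> supp (spread m b)"
  then have "dilation X a dvd j"
    using spread_not_dvd[OF assms, of j m] by (auto simp: supp_def)
  then obtain i where i: "j = dilation X a * i" ..
  with j have "0 < i" by (auto simp: supp_def)
  then have "i \<in> supp (m a)"
    using j spread_dilated[OF assms, of i m] by (simp add: i supp_def)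
  then show "j \<in> (\<lambda>i. dilation X a * i) ` supp (m a)"
    unfolding i by (rule imageI)
qed (use spread_dilated[OF assms, of _ m] in \<open>auto simp: supp_def\<close>)

lemma sum_supp_spread:
  assumes "a \<in> nodes X" "b \<in> iota X a"
  shows "(\<Sum>j\<in>supp (spread m b). f j (spread m b j)) =
         (\<Sum>i\<in>supp (m a). f (dilation X a * i) (m a i))"
proof -
  have "inj_on (\<lambda>i. dilation X a * i) (supp (m a))"
    using dilation_pos[of a] by (simp add: inj_on_def)
  then show ?thesis
    unfolding supp_spread[OF assms]
    by (auto simp: sum.reindex spread_dilated[OF assms] supp_def intro!: sum.cong)
qed

lemma finite_matrix_spread:
  assumes m: "\<forall>a i. m a i \<noteq> 0 \<longrightarrow> a \<in> nodes X \<and> 0 < i"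
  shows "finite_matrix Y (spread m) \<longleftrightarrow> finite_matrix X m"
proof -
  have "\<forall>b j. spread m b j \<noteq> 0 \<longrightarrow> b \<in> nodes Y \<and> 0 < j"
    using spread_unsupported[of _ _ m] by (metis neq0_conv)
  then have "finite_matrix Y (spread m) \<longleftrightarrow> (\<forall>b\<in>nodes Y. finite (supp (spread m b)))"
    by (rule finite_matrix_iff)
  also have "\<dots> \<longleftrightarrow> (\<forall>a\<in>nodes X. finite (supp (m a)))"
  proof (rule all_nodes_Y_iff)
    fix a b assume ab: "a \<in> nodes X" "b \<in> iota X a"
    show "finite (supp (spread m b)) \<longleftrightarrow> finite (supp (m a))"
      unfolding supp_spread[OF ab] by (rule finite_image_iff) (simp add: inj_on_def)
  qed
  also have "\<dots> \<longleftrightarrow> finite_matrix X m"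
    using m by (rule finite_matrix_iff[symmetric])
  finally show ?thesis .
qed

lemma virtual_L_spread:
  assumes "finite_matrix X L" "a \<in> nodes X" "b \<in> iota X a"
  shows "virtual_L X Y L b j = doubling a * spread L b j"
proof -
  have b: "b \<in> nodes Y" using assms by (auto simp: nodes_Y)
  have L0: "L a 0 = 0" using assms(1) by (auto simp: finite_matrix_def)
  have v: "virtual_L X Y L b j =
      doubling a * (if dilation X a dvd j then L a (j div dilation X a) else 0)"
    using b assms by (auto simp: virtual_L_def orbit_index_eq doubling_def dilation_def Let_def)
  show ?thesis
  proof (cases "dilation X a dvd j \<and> j \<noteq> 0")
    case True
    then obtain i where "j = dilation X a * i" "0 < i" by auto
    then show ?thesis using v assms dilation_pos[of a] by (simp add: spread_dilated)
  next
    case False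
    then show ?thesis using v L0 assms by (auto simp: spread_not_dvd)
  qed
qed

text \<open>
  The multiplicities \<open>virtual_L X Y L\<close> are a spread family up to the factor \<open>doubling a\<close>, so all
  sums over them reduce to sums over \<open>L\<close>.
\<close>

lemma sum_supp_virtual_L:
  assumes "finite_matrix X L" "a \<in> nodes X" "b \<in> iota X a"
  shows "(\<Sum>j\<in>supp (virtual_L X Y L b). f j * real (virtual_L X Y L b j)) =
         doubling a * (\<Sum>i\<in>supp (L a). f (dilation X a * i) * real (L a i))"
proof -
  have s: "supp (virtual_L X Y L b) = supp (spread L b)"
    using doubling_pos by (simp add: supp_def virtual_L_spread[OF assms])
  show ?thesis
    unfolding s virtual_L_spread[OF assms]
      sum_supp_spread[OF assms(2,3), of "\<lambda>j x. f j * real x" L, symmetric]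
    by (simp add: sum_distrib_left mult_ac)
qed

section \<open>Vacancy numbers\<close>

text \<open>
  The sum over \<open>nodes Y\<close> is split into orbits; on an orbit the rows of the spread matrix coincide, so
  only the form depends on the node, and \<open>folded_form\<close> evaluates the sum. The weight function \<open>h\<close>
  is kept general: for \<open>h k = min j k\<close> the result concerns vacancy numbers and the cocharge, for
  \<open>h k = k\<close> it concerns weights.
\<close>

lemma sum_form_spread:
  assumes "a \<in> nodes X" "b \<in> iota X a"
  shows "real (dilation X a) *
      (\<Sum>b'\<in>nodes Y. \<Sum>k\<in>supp (spread m b'). form Y b b' * h k * real (spread m b' k)) =
    real (gamma X a) / t_dual X a *
      (\<Sum>a'\<in>nodes X. \<Sum>k\<in>supp (m a').
        form X a a' * (t_factor X a' * h (dilation X a' * k)) * real (m a' k))"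
proof -
  let ?S = "\<lambda>a'. \<Sum>k\<in>supp (m a'). h (dilation X a' * k) * real (m a' k)"
  have "(\<Sum>b'\<in>nodes Y. \<Sum>k\<in>supp (spread m b'). form Y b b' * h k * real (spread m b' k))
      = (\<Sum>a'\<in>nodes X. \<Sum>b'\<in>iota X a'. form Y b b' * ?S a')"
    unfolding sum_nodes_Y
    by (intro sum.cong refl, subst sum_supp_spread, assumption+)
       (simp add: sum_distrib_left mult_ac)
  also have "\<dots> = (\<Sum>a'\<in>nodes X. (\<Sum>b'\<in>iota X a'. form Y b b') * ?S a')"
    by (simp add: sum_distrib_right)
  finally have "real (dilation X a) *
      (\<Sum>b'\<in>nodes Y. \<Sum>k\<in>supp (spread m b'). form Y b b' * h k * real (spread m b' k)) =
      (\<Sum>a'\<in>nodes X. (real (dilation X a) * (\<Sum>b'\<in>iota X a'. form Y b b')) * ?S a')"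
    by (simp add: sum_distrib_left mult_ac)
  also have "\<dots> = (\<Sum>a'\<in>nodes X.
      real (gamma X a) / t_dual X a * form X a a' * t_factor X a' * ?S a')"
    using folded_form assms by (intro sum.cong) auto
  also have "\<dots> = real (gamma X a) / t_dual X a *
      (\<Sum>a'\<in>nodes X. \<Sum>k\<in>supp (m a').
        form X a a' * (t_factor X a' * h (dilation X a' * k)) * real (m a' k))"
    by (simp add: sum_distrib_left sum_divide_distrib mult_ac)
  finally show ?thesis .
qed

lemma min_dilated:
  assumes "a \<in> nodes X" "a' \<in> nodes X"
  shows "t_factor X a' * min (real (dilation X a * i)) (real (dilation X a' * k)) =
    real (dilation X a) * min (t_factor X a' * real i) (t_factor X a * real k)"
proof -
  have "t_factor X a' * min (real (dilation X a * i)) (real (dilation X a' * k)) =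
    min (t_factor X a' * real (dilation X a * i)) (t_factor X a' * real (dilation X a' * k))"
    using t_factor_pos[of a'] by (simp add: min_def)
  also have "t_factor X a' * real (dilation X a' * k) = real (dilation X a) * (t_factor X a * real k)"
    using dilation_t_factor[OF assms] by (simp add: algebra_simps)
  also have "t_factor X a' * real (dilation X a * i) = real (dilation X a) * (t_factor X a' * real i)"
    by simp
  finally show ?thesis
    using dilation_pos[of a] by (simp add: min_def)
qed

lemma form_sum_spread:
  assumes "a \<in> nodes X" "b \<in> iota X a"
  shows "(\<Sum>b'\<in>nodes Y. \<Sum>k\<in>supp (spread m b').
      form Y b b' * min (real (dilation X a * i)) (real k) * real (spread m b' k)) =
    real (gamma X a) / t_dual X a *
      (\<Sum>a'\<in>nodes X. \<Sum>k\<in>supp (m a').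
        form X a a' * min (t_factor X a' * real i) (t_factor X a * real k) * real (m a' k))"
    (is "?l = _ * ?r")
proof -
  have "real (dilation X a) * ?l = real (gamma X a) / t_dual X a *
      (\<Sum>a'\<in>nodes X. \<Sum>k\<in>supp (m a').
        form X a a' * (t_factor X a' * min (real (dilation X a * i)) (real (dilation X a' * k))) * real (m a' k))"
    by (rule sum_form_spread[OF assms])
  also have "\<dots> = real (gamma X a) / t_dual X a * (real (dilation X a) * ?r)"
    using min_dilated[OF assms(1)] by (simp add: sum_distrib_left mult_ac)
  finally have "real (dilation X a) * ?l =
      real (dilation X a) * (real (gamma X a) / t_dual X a * ?r)"
    by (simp only: mult.left_commute)
  then show ?thesis by (subst (asm) mult_cancel_left) simp
qed

lemma vacancy_dilated:
  assumes L: "finite_matrix X L" and ab: "a \<in> nodes X" "b \<in> iota X a"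
  shows "vacancy Y (virtual_L X Y L) (spread m) b (dilation X a * i) =
    real (gamma X a) * vacancy X L m a i"
proof -
  have min_scale: "real (min (dilation X a * i) (dilation X a * k)) =
      real (dilation X a) * real (min i k)" for k
    by (simp flip: nat_mult_min_right)
  have "(\<Sum>k\<in>supp (virtual_L X Y L b).
      real (virtual_L X Y L b k) * real (min (dilation X a * i) k)) =
    doubling a * (\<Sum>k\<in>supp (L a). real (min (dilation X a * i) (dilation X a * k)) * real (L a k))"
    using sum_supp_virtual_L[OF L ab, of "\<lambda>k. real (min (dilation X a * i) k)"]
    by (simp add: mult_ac)
  also have "\<dots> = real (doubling a * dilation X a) *
      (\<Sum>k\<in>supp (L a). real (L a k) * real (min i k))"
    unfolding min_scale by (simp add: sum_distrib_left mult_ac)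
  also have "doubling a * dilation X a = gamma X a"
    by (rule doubling_dilation[OF ab(1)])
  finally show ?thesis
    unfolding vacancy_def simply_laced
    using form_sum_spread[OF ab, where m = m and i = i] by (simp add: algebra_simps)
qed

text \<open>
  The vacancy number is a combination of the functions \<open>j \<mapsto> min j k\<close>. For the tensor factors these
  occur with nonnegative coefficients, and for the rows other than \<open>b\<close> too, since there the form
  is nonpositive and enters with a minus sign. Only row \<open>b\<close> itself contributes with the wrong
  sign, but its entries sit at multiples of the dilation factor, where \<open>min_interpolation_dvd\<close>
  gives equality. Hence the vacancy number lies above its chords over consecutive multiples.
\<close>

lemma vacancy_interpolation:
  fixes m :: "nat \<Rightarrow> nat \<Rightarrow> nat"
  assumes L: "finite_matrix X L" and ab: "a \<in> nodes X" "b \<in> iota X a"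
    and s: "s \<le> dilation X a"
  defines "p \<equiv> vacancy Y (virtual_L X Y L) (spread m) b"
  shows "real (dilation X a - s) * p (dilation X a * q) + real s * p (dilation X a * q + dilation X a)
         \<le> real (dilation X a) * p (dilation X a * q + s)"
proof -
  let ?d = "dilation X a"
  let ?A = "\<lambda>j. \<Sum>k\<in>supp (virtual_L X Y L b). real (virtual_L X Y L b k) * real (min j k)"
  let ?B = "\<lambda>j. \<Sum>b'\<in>nodes Y. \<Sum>k\<in>supp (spread m b').
      form Y b b' * real (min j k) * real (spread m b' k)"
  have p: "p j = ?A j - ?B j" for j
    unfolding p_def vacancy_def simply_laced by (simp add: of_nat_min)
  have "real (?d - s) * ?A (?d * q) + real s * ?A (?d * q + ?d) =
     (\<Sum>k\<in>supp (virtual_L X Y L b). real (virtual_L X Y L b k) *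
       (real (?d - s) * real (min (?d * q) k) + real s * real (min (?d * q + ?d) k)))"
    by (simp only: sum_distrib_left flip: sum.distrib) (simp only: algebra_simps)
  also have "\<dots> \<le> (\<Sum>k\<in>supp (virtual_L X Y L b). real (virtual_L X Y L b k) *
       (real ?d * real (min (?d * q + s) k)))"
    by (intro sum_mono mult_left_mono min_interpolation s) auto
  also have "\<dots> = real ?d * ?A (?d * q + s)"
    by (simp only: sum_distrib_left) (simp only: algebra_simps)
  finally have A: "real (?d - s) * ?A (?d * q) + real s * ?A (?d * q + ?d) \<le>
      real ?d * ?A (?d * q + s)" .
  have "real ?d * ?B (?d * q + s) = (\<Sum>b'\<in>nodes Y. \<Sum>k\<in>supp (spread m b').
      form Y b b' * (real ?d * real (min (?d * q + s) k)) * real (spread m b' k))"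
    by (simp only: sum_distrib_left) (simp only: algebra_simps)
  also have "\<dots> \<le> (\<Sum>b'\<in>nodes Y. \<Sum>k\<in>supp (spread m b'). form Y b b' *
       (real (?d - s) * real (min (?d * q) k) + real s * real (min (?d * q + ?d) k)) *
       real (spread m b' k))"
  proof (intro sum_mono mult_right_mono)
    fix b' k assume k: "k \<in> supp (spread m b')"
    show "form Y b b' * (real ?d * real (min (?d * q + s) k)) \<le> form Y b b' *
       (real (?d - s) * real (min (?d * q) k) + real s * real (min (?d * q + ?d) k))"
    proof (cases "b' = b")
      case True
      then have "?d dvd k"
        using k spread_not_dvd[OF ab, of k m] by (auto simp: supp_def)
      then show ?thesis by (simp only: min_interpolation_dvd[OF s])
    next
      case False
      then show ?thesis
        using form_Y_offdiag[of b b'] by (intro mult_left_mono_neg min_interpolation s) auto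
    qed
  qed auto
  also have "\<dots> = real (?d - s) * ?B (?d * q) + real s * ?B (?d * q + ?d)"
    by (simp only: sum_distrib_left flip: sum.distrib) (simp only: algebra_simps)
  finally show ?thesis
    using A unfolding p by (simp only: right_diff_distrib)
qed

lemma vacancy_0: "vacancy Y L' m' b 0 = 0"
  by (simp add: vacancy_def simply_laced)

text \<open>
  At multiples of the dilation factor the vacancy numbers of \<open>Y\<close> are positive multiples of those of
  \<open>X\<close>; the other indices follow by interpolation. The left end point of the first interval is \<open>0\<close>,
  where the vacancy number vanishes.
\<close>

lemma vacancy_nonneg_iff:
  assumes L: "finite_matrix X L" and ab: "a \<in> nodes X" "b \<in> iota X a"
  shows "(\<forall>j>0. 0 \<le> vacancy Y (virtual_L X Y L) (spread m) b j) \<longleftrightarrow>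
         (\<forall>i>0. 0 \<le> vacancy X L m a i)"
    (is "?l \<longleftrightarrow> ?r")
proof
  assume ?l
  show ?r
  proof (intro allI impI)
    fix i :: nat assume "0 < i"
    then have "0 \<le> real (gamma X a) * vacancy X L m a i"
      using \<open>?l\<close> unfolding vacancy_dilated[OF L ab, symmetric] by simp
    then show "0 \<le> vacancy X L m a i"
      using gamma_pos[of a] by (simp add: zero_le_mult_iff)
  qed
next
  assume ?r
  let ?p = "vacancy Y (virtual_L X Y L) (spread m) b" and ?d = "dilation X a"
  have mult: "0 \<le> ?p (?d * i)" for i
  proof (cases "i = 0")
    case False
    then show ?thesis unfolding vacancy_dilated[OF L ab] using \<open>?r\<close> by simp
  qed (simp add: vacancy_0)
  show ?l
  proof (intro allI impI)
    fix j :: nat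
    let ?q = "j div ?d" and ?s = "j mod ?d"
    have "real (?d - ?s) * ?p (?d * ?q) + real ?s * ?p (?d * ?q + ?d) \<le> real ?d * ?p (?d * ?q + ?s)"
      by (rule vacancy_interpolation[OF L ab]) simp
    moreover have "0 \<le> real (?d - ?s) * ?p (?d * ?q) + real ?s * ?p (?d * ?q + ?d)"
      using mult[of ?q] mult[of "Suc ?q"] by (simp add: add.commute)
    ultimately have "0 \<le> real ?d * ?p j" by (simp only: mult_div_mod_eq)
    then show "0 \<le> ?p j"
      using dilation_pos[of a] by (simp add: zero_le_mult_iff)
  qed
qed

section \<open>Weights\<close>

lemma tensor_weight_virtual:
  assumes L: "finite_matrix X L" and ab: "a \<in> nodes X" "b \<in> iota X a"
  shows "tensor_weight Y (virtual_L X Y L) b = int (gamma X a) * tensor_weight X L a"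
proof -
  have "b \<in> nodes Y" using ab by (auto simp: nodes_Y)
  then have "real_of_int (tensor_weight Y (virtual_L X Y L) b) =
      (\<Sum>j\<in>supp (virtual_L X Y L b). real j * real (virtual_L X Y L b j))"
    by (simp add: tensor_weight_eq)
  also have "\<dots> = real (doubling a * dilation X a) * (\<Sum>i\<in>supp (L a). real i * real (L a i))"
    unfolding sum_supp_virtual_L[OF L ab] by (simp add: sum_distrib_left mult_ac)
  also have "\<dots> = real_of_int (int (gamma X a) * tensor_weight X L a)"
    unfolding doubling_dilation[OF ab(1)] using ab by (simp add: tensor_weight_eq)
  finally show ?thesis by (simp only: of_int_eq_iff)
qed

lemma Psi_iota:
  assumes ab: "a \<in> nodes X" "b \<in> iota X a"
  shows "Psi X \<mu> b = int (gamma X a) * \<mu> a"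
proof -
  have "Psi X \<mu> b = (\<Sum>a'\<in>nodes X. if a' = a then \<mu> a * int (gamma X a) else 0)"
    unfolding Psi_def
  proof (intro sum.cong refl)
    fix a' assume "a' \<in> nodes X"
    then have "b \<in> iota X a' \<longleftrightarrow> a' = a"
      using ab iota_disjoint by blast
    then show "\<mu> a' * (int (gamma X a') * (\<Sum>b'\<in>iota X a'. fundamental_weight b' b)) =
        (if a' = a then \<mu> a * int (gamma X a) else 0)"
      by (simp add: fundamental_weight_def iota_finite)
  qed
  then show ?thesis using ab finite_nodes[of X] by simp
qed

text \<open>
  The factors on the two sides are those which the right-hand sides of the weight equations
  require in \<open>configuration_spread\<close>: passing to \<open>Y\<close> multiplies \<open>tensor_weight\<close> and \<open>\<mu>\<close> by \<open>\<gamma>\<^sub>a\<close>, while \<open>weight_map X\<close>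
  already contains \<open>doubling a\<close>.
\<close>

lemma root_sum_spread:
  assumes ab: "a \<in> nodes X" "b \<in> iota X a"
  shows "real (doubling a) * (\<Sum>b'\<in>nodes Y. \<Sum>j\<in>supp (spread m b').
      real j * real (spread m b' j) * simple_root Y b' b) =
    real (gamma X a) * (\<Sum>a'\<in>nodes X. \<Sum>i\<in>supp (m a').
      real i * real (m a' i) * simple_root X a' a)"
proof -
  let ?F = "\<Sum>a'\<in>nodes X. \<Sum>i\<in>supp (m a'). form X a a' * real i * real (m a' i)"
  let ?l = "\<Sum>b'\<in>nodes Y. \<Sum>j\<in>supp (spread m b'). form Y b b' * real j * real (spread m b' j)"
  have bY: "b \<in> nodes Y" using ab by (auto simp: nodes_Y)
  have "real (dilation X a) * ?l = real (gamma X a) / t_dual X a *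
      (\<Sum>a'\<in>nodes X. \<Sum>k\<in>supp (m a').
        form X a a' * (t_factor X a' * real (dilation X a' * k)) * real (m a' k))"
    by (rule sum_form_spread[OF ab])
  also have "\<dots> = real (gamma X a) / t_dual X a *
      (\<Sum>a'\<in>nodes X. \<Sum>k\<in>supp (m a').
        form X a a' * (t_factor X a * real (dilation X a) * real k) * real (m a' k))"
  proof -
    have "t_factor X a' * real (dilation X a' * k) = t_factor X a * real (dilation X a) * real k"
      if "a' \<in> nodes X" for a' k
      using dilation_t_factor[OF ab(1) that] by (simp add: mult_ac)
    then show ?thesis by (simp only: cong: sum.cong)
  qed
  also have "\<dots> = real (dilation X a) * (real (gamma X a) / t_dual X a * t_factor X a * ?F)"
    by (simp add: sum_distrib_left sum_divide_distrib mult_ac)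
  finally have l: "?l = real (gamma X a) / t_dual X a * t_factor X a * ?F"
    by (subst (asm) mult_cancel_left) simp
  have "(\<Sum>b'\<in>nodes Y. \<Sum>j\<in>supp (spread m b').
      real j * real (spread m b' j) * simple_root Y b' b) = ?l"
    using bY by (simp add: simple_root_def form_def[of Y b b] simply_laced mult_ac)
  moreover have "(\<Sum>a'\<in>nodes X. \<Sum>i\<in>supp (m a').
      real i * real (m a' i) * simple_root X a' a) = 2 / sq_length X a * ?F"
    using ab by (simp add: simple_root_def form_def[of X a a] sum_distrib_left mult_ac sum_divide_distrib)
  moreover have "real (doubling a) * (real (gamma X a) / t_dual X a * t_factor X a) =
      real (gamma X a) * (2 / sq_length X a)"
  proof -
    have "real (doubling a) * (t_factor X a / t_dual X a) = 2 / sq_length X a"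
      using weight_scale[OF ab(1)] sq_length_pos[of a]
      by (auto simp: eq_divide_eq doubling_def mult_ac)
    then have "real (gamma X a) * (real (doubling a) * (t_factor X a / t_dual X a)) =
        real (gamma X a) * (2 / sq_length X a)"
      by simp
    then show ?thesis by (simp add: mult_ac)
  qed
  ultimately show ?thesis
    unfolding l by (simp only: mult.assoc[symmetric])
qed

lemma configuration_spread:
  assumes L: "finite_matrix X L" and m: "\<forall>a i. m a i \<noteq> 0 \<longrightarrow> a \<in> nodes X \<and> 0 < i"
  shows "configuration Y (virtual_L X Y L) (Psi X \<mu>) (spread m) \<longleftrightarrow> configuration X L \<mu> m"
proof -
  have "(\<Sum>b'\<in>nodes Y. \<Sum>j\<in>supp (spread m b').
      real j * real (spread m b' j) * simple_root Y b' b) =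
      of_int (weight_map Y (\<lambda>d. tensor_weight Y (virtual_L X Y L) d - Psi X \<mu> d) b) \<longleftrightarrow>
    (\<Sum>a'\<in>nodes X. \<Sum>i\<in>supp (m a'). real i * real (m a' i) * simple_root X a' a) =
      of_int (weight_map X (\<lambda>d. tensor_weight X L d - \<mu> d) a)"
    (is "?l = ?l' \<longleftrightarrow> ?r = ?r'")
    if ab: "a \<in> nodes X" "b \<in> iota X a" for a b
  proof -
    have "?l = ?l' \<longleftrightarrow> real (doubling a) * ?l = real (doubling a) * ?l'"
      using doubling_pos[of a] by simp
    also have "real (doubling a) * ?l = real (gamma X a) * ?r"
      by (rule root_sum_spread[OF ab])
    also have "real (doubling a) * ?l' = real (gamma X a) * ?r'"
      unfolding weight_map_X weight_map_Y tensor_weight_virtual[OF L ab] Psi_iota[OF ab]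
      by (simp add: algebra_simps)
    finally show ?thesis
      using gamma_pos[of a] by simp
  qed
  then show ?thesis
    unfolding configuration_def finite_matrix_spread[OF m]
    by (intro arg_cong2[where f = "(\<and>)"] refl all_nodes_Y_iff)
qed

section \<open>Cocharge\<close>

text \<open>
  In the quadratic term, \<open>form_sum_spread\<close> evaluates the sum over one index for a fixed node
  \<open>b\<close> of the other; the result depends only on the orbit of \<open>b\<close>, so the remaining sum multiplies it
  by the size of the orbit. By \<open>card_iota\<close> the total factor is \<open>\<gamma>\<^sub>0\<close>, as it is for the linear
  term.
\<close>

lemma cocharge_spread:
  fixes J :: "nat \<Rightarrow> nat \<Rightarrow> nat multiset"
  shows "cocharge Y (spread m, spread (\<lambda>a i. scale_partition (gamma X a) (J a i))) =
         real (gamma X 0) * cocharge X (m, J)"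
proof -
  let ?J = "spread (\<lambda>a i. scale_partition (gamma X a) (J a i))"
  let ?F = "\<lambda>a i. \<Sum>a'\<in>nodes X. \<Sum>k\<in>supp (m a').
      form X a a' * min (t_factor X a' * real i) (t_factor X a * real k) * real (m a' k)"
  let ?G = "\<lambda>b j. \<Sum>b'\<in>nodes Y. \<Sum>k\<in>supp (spread m b').
      form Y b b' * min (real j) (real k) * real (spread m b' k)"
  have factor: "real (card (iota X a)) * (real (gamma X a) / t_dual X a) = real (gamma X 0)"
    if "a \<in> nodes X" for a
    using card_iota[OF that] t_dual_pos[OF that] by (simp add: field_simps)
  \<comment> \<open>isolates the inner double sum of the quadratic term, which is a sum as in
    \<open>form_sum_spread\<close> for fixed \<open>a\<close> and \<open>j\<close>\<close>
  have swap: "(\<Sum>a\<in>nodes T. \<Sum>b\<in>nodes T. \<Sum>j\<in>supp (n a). \<Sum>k\<in>supp (n b).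
      h a b j k * real (n a j) * real (n b k)) =
    (\<Sum>a\<in>nodes T. \<Sum>j\<in>supp (n a).
      (\<Sum>b\<in>nodes T. \<Sum>k\<in>supp (n b). h a b j k * real (n b k)) * real (n a j))"
    for T n and h :: "nat \<Rightarrow> nat \<Rightarrow> nat \<Rightarrow> nat \<Rightarrow> real"
    by (rule sum.cong[OF refl], subst sum.swap) (simp add: sum_distrib_left mult_ac)
  have peel: "(\<Sum>j\<in>supp (spread m b). ?G b j * real (spread m b j)) =
      (\<Sum>i\<in>supp (m a). ?G b (dilation X a * i) * real (m a i))"
    if "a \<in> nodes X" "b \<in> iota X a" for a b
    by (rule sum_supp_spread[OF that, where f = "\<lambda>j x. ?G b j * real x"])
  have "(\<Sum>b\<in>nodes Y. \<Sum>j\<in>supp (spread m b). ?G b j * real (spread m b j)) =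
    (\<Sum>a\<in>nodes X. \<Sum>b\<in>iota X a. \<Sum>i\<in>supp (m a). ?G b (dilation X a * i) * real (m a i))"
    by (subst sum_nodes_Y, intro sum.cong refl peel)
  also have "\<dots> = (\<Sum>a\<in>nodes X. \<Sum>b\<in>iota X a.
      \<Sum>i\<in>supp (m a). (real (gamma X a) / t_dual X a * ?F a i) * real (m a i))"
    using form_sum_spread by (intro sum.cong refl) auto
  also have "\<dots> = (\<Sum>a\<in>nodes X. (real (card (iota X a)) * (real (gamma X a) / t_dual X a)) *
      (\<Sum>i\<in>supp (m a). ?F a i * real (m a i)))"
    by (simp add: sum_distrib_left mult_ac)
  also have "\<dots> = real (gamma X 0) * (\<Sum>a\<in>nodes X. \<Sum>i\<in>supp (m a). ?F a i * real (m a i))"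
    unfolding sum_distrib_left[of "real (gamma X 0)"]
    by (intro sum.cong refl) (simp only: factor sum_distrib_left)
  finally have quadratic: "(\<Sum>b\<in>nodes Y. \<Sum>j\<in>supp (spread m b). ?G b j * real (spread m b j)) =
      real (gamma X 0) * (\<Sum>a\<in>nodes X. \<Sum>i\<in>supp (m a). ?F a i * real (m a i))" .

  have rigging: "(\<Sum>j | 0 < j \<and> ?J b j \<noteq> {#}. real (\<Sum>\<^sub># (?J b j))) =
      real (gamma X a) * (\<Sum>i | 0 < i \<and> J a i \<noteq> {#}. real (\<Sum>\<^sub># (J a i)))"
    if ab: "a \<in> nodes X" "b \<in> iota X a" for a b
  proof -
    have set_eq: "{j. 0 < j \<and> ?J b j \<noteq> {#}} = (\<lambda>i. dilation X a * i) ` {i. 0 < i \<and> J a i \<noteq> {#}}"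
    proof (intro equalityI subsetI)
      fix j assume j: "j \<in> {j. 0 < j \<and> ?J b j \<noteq> {#}}"
      then have "dilation X a dvd j"
        using spread_not_dvd[OF ab, of j "\<lambda>a i. scale_partition (gamma X a) (J a i)"] by auto
      then obtain i where i: "j = dilation X a * i" ..
      with j have "0 < i" by auto
      then have "i \<in> {i. 0 < i \<and> J a i \<noteq> {#}}"
        using j spread_dilated[OF ab, of i "\<lambda>a i. scale_partition (gamma X a) (J a i)"]
        by (auto simp: i scale_partition_def)
      then show "j \<in> (\<lambda>i. dilation X a * i) ` {i. 0 < i \<and> J a i \<noteq> {#}}"
        unfolding i by (rule imageI)
    qed (use spread_dilated[OF ab, of _ "\<lambda>a i. scale_partition (gamma X a) (J a i)"] in
          \<open>auto simp: scale_partition_def\<close>)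
    have inj: "inj_on (\<lambda>i. dilation X a * i) {i. 0 < i \<and> J a i \<noteq> {#}}"
      by (simp add: inj_on_def)
    show ?thesis
      unfolding set_eq sum.reindex[OF inj] sum_distrib_left
      by (intro sum.cong refl)
         (simp only: mem_Collect_eq spread_dilated[OF ab] sum_scale_partition of_nat_mult o_def)
  qed
  have "(\<Sum>b\<in>nodes Y. \<Sum>j | 0 < j \<and> ?J b j \<noteq> {#}. real (\<Sum>\<^sub># (?J b j))) =
      (\<Sum>a\<in>nodes X. real (card (iota X a)) * real (gamma X a) *
         (\<Sum>i | 0 < i \<and> J a i \<noteq> {#}. real (\<Sum>\<^sub># (J a i))))"
    unfolding sum_nodes_Y using rigging by (simp add: mult.assoc)
  also have "\<dots> = real (gamma X 0) * (\<Sum>a\<in>nodes X. \<Sum>i | 0 < i \<and> J a i \<noteq> {#}.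
      t_dual X a * real (\<Sum>\<^sub># (J a i)))"
    using card_iota by (simp add: sum_distrib_left mult.assoc)
  finally have linear: "(\<Sum>b\<in>nodes Y. \<Sum>j | 0 < j \<and> ?J b j \<noteq> {#}. real (\<Sum>\<^sub># (?J b j))) =
      real (gamma X 0) * (\<Sum>a\<in>nodes X. \<Sum>i | 0 < i \<and> J a i \<noteq> {#}.
        t_dual X a * real (\<Sum>\<^sub># (J a i)))" .
  have "cocharge X (m, J) = 1 / 2 * (\<Sum>a\<in>nodes X. \<Sum>i\<in>supp (m a). ?F a i * real (m a i)) +
      (\<Sum>a\<in>nodes X. \<Sum>i | 0 < i \<and> J a i \<noteq> {#}. t_dual X a * real (\<Sum>\<^sub># (J a i)))"
    unfolding cocharge.simps by (intro arg_cong2[where f = "(+)"] arg_cong2[where f = "(*)"] refl swap)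
  moreover have "cocharge Y (spread m, ?J) =
      1 / 2 * (\<Sum>b\<in>nodes Y. \<Sum>j\<in>supp (spread m b). ?G b j * real (spread m b j)) +
      (\<Sum>b\<in>nodes Y. \<Sum>j | 0 < j \<and> ?J b j \<noteq> {#}. real (\<Sum>\<^sub># (?J b j)))"
    unfolding cocharge.simps simply_laced mult_1
    by (intro arg_cong2[where f = "(+)"] arg_cong2[where f = "(*)"] refl swap)
  ultimately show ?thesis
    unfolding quadratic linear by (simp only: distrib_left mult.left_commute)
qed

section \<open>The bijection\<close>

definition virtualization :: "rigged_configuration \<Rightarrow> rigged_configuration" where
  "virtualization = (\<lambda>(m, J). (spread m, spread (\<lambda>a i. scale_partition (gamma X a) (J a i))))"

lemma virtualizes_virtualization: "virtualizes X r (virtualization r)"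
proof (cases r)
  case (Pair m J)
  show ?thesis
    unfolding Pair virtualization_def prod.case virtualizes.simps
    by (intro conjI ballI allI impI spread_outside) (simp_all add: spread_dilated)
qed

text \<open>
  Being a rigged configuration is both preserved and reflected. The reflection is what makes a
  preimage of a virtual rigged configuration a rigged configuration again.
\<close>

lemma virtualization_in_RC_iff:
  assumes L: "finite_matrix X L"
    and m: "\<forall>a i. m a i \<noteq> 0 \<longrightarrow> a \<in> nodes X \<and> 0 < i"
    and J: "\<And>a i. a \<notin> nodes X \<or> i = 0 \<Longrightarrow> J a i = {#}"
  shows "virtualization (m, J) \<in> RC Y (virtual_L X Y L) (Psi X \<mu>) \<longleftrightarrow> (m, J) \<in> RC X L \<mu>"
proof -
  let ?m = "spread m" and ?J = "spread (\<lambda>a i. scale_partition (gamma X a) (J a i))"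
  let ?p = "vacancy Y (virtual_L X Y L) ?m" and ?q = "vacancy X L m"
  let ?R = "\<lambda>b j. 0 \<notin># ?J b j \<and> size (?J b j) \<le> ?m b j \<and> (\<forall>x\<in>#?J b j. real x \<le> ?p b j)"
  let ?S = "\<lambda>a i. 0 \<notin># J a i \<and> size (J a i) \<le> m a i \<and> (\<forall>x\<in>#J a i. real x \<le> ?q a i)"
  have adm: "?m \<in> admissible_configurations Y (virtual_L X Y L) (Psi X \<mu>) \<longleftrightarrow>
      m \<in> admissible_configurations X L \<mu>"
    unfolding admissible_configurations_def mem_Collect_eq configuration_spread[OF L m]
    by (intro arg_cong2[where f = "(\<and>)"] refl all_nodes_Y_iff vacancy_nonneg_iff[OF L])
  have rig: "(\<forall>b\<in>nodes Y. \<forall>j>0. ?R b j) \<longleftrightarrow> (\<forall>a\<in>nodes X. \<forall>i>0. ?S a i)"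
  proof (rule all_nodes_Y_iff)
    fix a b assume ab: "a \<in> nodes X" "b \<in> iota X a"
    have mult: "?R b (dilation X a * i) \<longleftrightarrow> ?S a i" if "0 < i" for i
      using gamma_pos[of a]
      by (auto simp: spread_dilated[OF ab that] vacancy_dilated[OF L ab] scale_partition_def)
    have triv: "?R b j" if "\<not> dilation X a dvd j" for j
      using that by (simp add: spread_not_dvd[OF ab])
    show "(\<forall>j>0. ?R b j) \<longleftrightarrow> (\<forall>i>0. ?S a i)"
    proof (intro iffI allI impI)
      fix i :: nat assume "\<forall>j>0. ?R b j" "0 < i"
      then have "?R b (dilation X a * i)" by simp
      then show "?S a i" using mult \<open>0 < i\<close> by blast
    next
      fix j :: nat assume S: "\<forall>i>0. ?S a i" and "0 < j"
      show "?R b j"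
      proof (cases "dilation X a dvd j")
        case True
        then obtain i where i: "j = dilation X a * i" "0 < i" using \<open>0 < j\<close> by auto
        show ?thesis unfolding i(1) mult[OF i(2)] using S i(2) by blast
      qed (rule triv)
    qed
  qed
  have "\<forall>b j. b \<notin> nodes Y \<or> j = 0 \<longrightarrow> ?J b j = {#}"
    by (simp add: spread_unsupported)
  moreover have "\<forall>a i. a \<notin> nodes X \<or> i = 0 \<longrightarrow> J a i = {#}"
    using J by blast
  ultimately show ?thesis
    unfolding RC_def virtualization_def prod.case mem_Collect_eq adm rig by simp
qed

lemma virtualization_in_RC_virtual:
  assumes L: "finite_matrix X L" and r: "r \<in> RC X L \<mu>"
  shows "virtualization r \<in> RC_virtual X Y L \<mu>"
proof -
  obtain m J where mJ: "r = (m, J)" by (cases r)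
  let ?J = "spread (\<lambda>a i. scale_partition (gamma X a) (J a i))"
  have "virtualization (m, J) \<in> RC Y (virtual_L X Y L) (Psi X \<mu>)"
    using virtualization_in_RC_iff[OF L, of m J] RC_supported(1,3)[OF r[unfolded mJ]] r
    unfolding mJ by blast
  then have RC: "(spread m, ?J) \<in> RC Y (virtual_L X Y L) (Psi X \<mu>)"
    by (simp add: virtualization_def)
  have orbit: "spread m b i = spread m b' i \<and> ?J b i = ?J b' i"
    "\<not> dilation X a dvd i \<longrightarrow> spread m b i = 0" "\<forall>x\<in>#?J b i. gamma X a dvd x"
    if ab: "a \<in> nodes X" "b \<in> iota X a" "b' \<in> iota X a" "0 < i" for a b b' i
  proof -
    have b: "spread m c i = 0 \<and> ?J c i = {#}" if "c \<in> iota X a" "\<not> dilation X a dvd i" for c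
      using ab(1) that by (simp add: spread_not_dvd)
    have d: "spread m c i = m a (i div dilation X a)"
      "?J c i = scale_partition (gamma X a) (J a (i div dilation X a))"
      if c: "c \<in> iota X a" and i: "dilation X a dvd i" for c
    proof -
      obtain k where k: "i = dilation X a * k" using i ..
      with ab(4) have "0 < k" by auto
      from spread_dilated[OF ab(1) c this] show "spread m c i = m a (i div dilation X a)"
        "?J c i = scale_partition (gamma X a) (J a (i div dilation X a))"
        by (simp_all add: k)
    qed
    show "spread m b i = spread m b' i \<and> ?J b i = ?J b' i"
      using b d ab by (cases "dilation X a dvd i") simp_all
    show "\<not> dilation X a dvd i \<longrightarrow> spread m b i = 0"
      using b ab by simp
    show "\<forall>x\<in>#?J b i. gamma X a dvd x"
      using b d ab by (cases "dilation X a dvd i") (auto simp: scale_partition_def)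
  qed
  show ?thesis
    unfolding mJ RC_virtual_def virtualization_def prod.case mem_Collect_eq
    by (intro conjI ballI allI impI RC orbit(1)[THEN conjunct1] orbit(1)[THEN conjunct2])
       (use orbit(2,3) in blast)+
qed

text \<open>
  A preimage is read off at one representative of each orbit, at the multiples of the dilation
  factor. Its image agrees with the given element on the remaining nodes by symmetry; at the
  remaining indices the matrix vanishes, which forces the partitions there to be empty.
\<close>

lemma virtualization_onto:
  assumes L: "finite_matrix X L" and r': "r' \<in> RC_virtual X Y L \<mu>"
  shows "r' \<in> virtualization ` RC X L \<mu>"
proof -
  obtain m' J' where mJ': "r' = (m', J')" by (cases r')
  define c where "c a = (SOME b. b \<in> iota X a)" for a
  have c: "c a \<in> iota X a" for a
    unfolding c_def using iota_nonempty by (simp add: some_in_eq)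
  define m where "m a i = (if a \<in> nodes X \<and> 0 < i then m' (c a) (dilation X a * i) else 0)" for a i
  define J where "J a i = (if a \<in> nodes X \<and> 0 < i
      then image_mset (\<lambda>x. x div gamma X a) (J' (c a) (dilation X a * i)) else {#})" for a i
  have RC': "(m', J') \<in> RC Y (virtual_L X Y L) (Psi X \<mu>)"
    and sym: "\<And>a b b' i. a \<in> nodes X \<Longrightarrow> b \<in> iota X a \<Longrightarrow> b' \<in> iota X a \<Longrightarrow> 0 < i \<Longrightarrow>
        m' b i = m' b' i \<and> J' b i = J' b' i"
    and dvd: "\<And>a b i. a \<in> nodes X \<Longrightarrow> b \<in> iota X a \<Longrightarrow> 0 < i \<Longrightarrow>
        (\<not> dilation X a dvd i \<longrightarrow> m' b i = 0) \<and> (\<forall>x\<in>#J' b i. gamma X a dvd x)"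
    using r' unfolding mJ' RC_virtual_def by blast+
  note supp' = RC_supported[OF RC']
  have m': "spread m = m'"
  proof (rule spread_eqI)
    fix a b i assume ab: "a \<in> nodes X" "b \<in> iota X a" "0 < (i::nat)"
    then show "m a i = m' b (dilation X a * i)"
      using sym[OF ab(1) c ab(2), of "dilation X a * i"] by (simp add: m_def)
  next
    fix a b j assume "a \<in> nodes X" "b \<in> iota X a" "0 < (j::nat)" "\<not> dilation X a dvd j"
    then show "m' b j = 0" by (simp add: dvd)
  qed (rule supp'(2))
  have J': "spread (\<lambda>a i. scale_partition (gamma X a) (J a i)) = J'"
  proof (rule spread_eqI)
    fix a b i assume ab: "a \<in> nodes X" "b \<in> iota X a" "0 < (i::nat)"
    then have "\<forall>x\<in>#J' (c a) (dilation X a * i). gamma X a dvd x"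
      using dvd[OF ab(1) c, of "dilation X a * i"] by simp
    then show "scale_partition (gamma X a) (J a i) = J' b (dilation X a * i)"
      using ab sym[OF ab(1) c ab(2), of "dilation X a * i"]
      by (simp add: J_def scale_partition_div)
  next
    fix a b j assume "a \<in> nodes X" "b \<in> iota X a" "0 < (j::nat)" "\<not> dilation X a dvd j"
    then show "J' b j = 0"
      using dvd supp'(4)[of b j] by (auto simp: nodes_Y)
  qed (rule supp'(3))
  have eq: "virtualization (m, J) = (m', J')"
    by (simp add: virtualization_def m' J')
  have "(m, J) \<in> RC X L \<mu>"
    by (subst virtualization_in_RC_iff[OF L, symmetric]) (auto simp: eq RC' m_def J_def)
  then show ?thesis
    unfolding mJ' using eq by (metis image_eqI)
qed

lemma virtualization_inj: "inj_on virtualization (RC X L \<mu>)"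
proof (rule inj_onI)
  fix r r' assume r: "r \<in> RC X L \<mu>" and r': "r' \<in> RC X L \<mu>"
    and eq: "virtualization r = virtualization r'"
  obtain m J m' J' where mJ: "r = (m, J)" "r' = (m', J')" by (cases r, cases r')
  note s = RC_supported[OF r[unfolded mJ]] and s' = RC_supported[OF r'[unfolded mJ]]
  have "m = m'"
  proof (rule spread_inject)
    show "spread m = spread m'" using eq by (simp add: mJ virtualization_def)
  qed (rule s(2) s'(2), assumption)+
  moreover have "(\<lambda>a i. scale_partition (gamma X a) (J a i)) =
      (\<lambda>a i. scale_partition (gamma X a) (J' a i))"
  proof (rule spread_inject)
    show "spread (\<lambda>a i. scale_partition (gamma X a) (J a i)) =
        spread (\<lambda>a i. scale_partition (gamma X a) (J' a i))"
      using eq by (simp add: mJ virtualization_def)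
  qed (simp_all add: s(3) s'(3) scale_partition_def)
  then have "J a i = J' a i" for a i
    using scale_partition_inject[OF gamma_pos] by metis
  ultimately show "r = r'" by (auto simp: mJ)
qed

lemma bij_betw_virtualization:
  assumes "finite_matrix X L"
  shows "bij_betw virtualization (RC X L \<mu>) (RC_virtual X Y L \<mu>)"
  unfolding bij_betw_def
  using virtualization_inj virtualization_in_RC_virtual[OF assms] virtualization_onto[OF assms]
  by blast

end

theorem theorem4p2:
  fixes X Y :: affine_type and L :: "nat \<Rightarrow> nat \<Rightarrow> nat" and \<mu> :: "nat \<Rightarrow> int"
  assumes "embedding_pair X Y"
    and "finite_matrix X L"
    and "dominant_weight X \<mu>"
  shows "\<exists>\<Phi>. bij_betw \<Phi> (RC X L \<mu>) (RC_virtual X Y L \<mu>) \<and>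
           (\<forall>r\<in>RC X L \<mu>.
              virtualizes X r (\<Phi> r) \<and>
              cocharge Y (\<Phi> r) = real (gamma X 0) * cocharge X r)"
proof -
  interpret embedding X Y by (unfold_locales) (rule assms(1))
  have "cocharge Y (virtualization r) = real (gamma X 0) * cocharge X r" for r
    by (cases r) (simp only: virtualization_def prod.case cocharge_spread)
  then show ?thesis
    using bij_betw_virtualization[OF assms(2)] virtualizes_virtualization by blast
qed

end
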